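(* Assume the standing assumptions (A1)–(A5) of the context, and let $\mathbf{D}$ be the positive definite $d\times d$ matrix (the diffusion matrix) such that for every $\psi_0\in \ell^2(\mathbb{Z}^d)$ with $\sup_xe^{\kappa|x|_1}|\psi_0(x)|<\infty$ for some $\kappa>0$ and every $t>0$, $\sum_{x}e^{i\mathbf{z}\cdot x/\sqrt\tau}\,\mathbb{E}(|\psi_{\tau t}(x)|^2)\to\|\psi_0\|_{\ell^2}^2e^{-\frac t2\mathbf{z}\cdot\mathbf{D}\mathbf{z}}$ as $\tau\to\infty$, uniformly for $\mathbf{z}$ in compact subsets of $\mathbb{C}^d$, where $\psi_t$ is the solution of $i\partial_t\psi_t(x)=K\psi_t(x)+v_x(\omega_t)\psi_t(x)$ with initial value $\psi_0$. Let $f:\mathbb{R}^d\to\mathbb{R}$ be a polynomially bounded continuous function. If $\psi_0\in\ell^2(\mathbb{Z}^d)$ satisfies $\sup_xe^{\kappa|x|_1}|\psi_0(x)|<\infty$ for some $\kappa>0$, then $$\lim_{t\to\infty}\sum_{x\in\mathbb{Z}^d}f\left(\frac{x}{\sqrt t}\right)\mathbb{E}\left(|\psi_t(x)|^2\right)=\|\psi_0\|_{\ell^2}^2\int_{\mathbb{R}^d}f(\mathbf{x})\,\frac{1}{\sqrt{(2\pi)^d\det\mathbf{D}}}\,e^{-\frac12\mathbf{x}\cdot\mathbf{D}^{-1}\mathbf{x}}\,d\mathbf{x}.$$ In particular, diffusive scaling holds: for each $p>0$ (and $\psi_0\ne0$), $\sum_x|x|^p\,\mathbb{E}(|\psi_t(x)|^2)\sim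 t^{p/2}$, i.e. $t^{-p/2}\sum_x|x|^p\,\mathbb{E}(|\psi_t(x)|^2)$ converges to a finite positive limit as $t\to\infty$.
   Context: Notation: $\mathbf{z}\cdot\mathbf{w}=\sum_j z_jw_j$ (bilinear, no conjugation); $|x|_1=\sum_j|x_j|$; $|x|$ is the Euclidean norm. The existence of the matrix $\mathbf{D}$ described in the claim is known under these assumptions. Standing assumptions. (A1) Hopping: $K\psi(x)=\sum_{y}h(x-y)\psi(y)$ on $\ell^2(\mathbb{Z}^d)$, with $h:\mathbb{Z}^d\to\mathbb{C}$, $h(\zeta)=\overline{h(-\zeta)}$, $\sum_y e^{m|y|_1}|h(y)|<\infty$ for some $m>0$, and for every non-zero $\mathbf{k}\in\mathbb{R}^d$ there is $y\in\mathbb{Z}^d$ with $\mathbf{k}\cdot y\ne0$ and $h(y)\neq0$. (A2) Probability space: $\Omega$ is a topological space, $\mu$ is a Borel probability measure on it, and $\sigma_x:\Omega\to\Omega$, $x\in\mathbb{Z}^d$, are $\mu$-measure preserving maps with $\sigma_0=\mathrm{id}$ and $\sigma_x\circ\sigma_y=\sigma_{x+y}$. (A3) Markov process: for each $a\in\Omega$ there is a probability measure $\mathbb{P}_a$ (expectation $\mathbb{E}_a$) on the $\sigma$-algebra generated by Borel cylinder sets of the path space $\mathcal{P}(\Omega)=\Omega^{[0,\infty)}$ such that: (i) $\mathbb{P}_a$-almost surely $t\mapsto\omega_t$ is right continuous with $\omega_0=a$; (ii) $\mathbb{P}_{\sigma_xa}=\mathbb{P}_a\circ\mathcal{S}_x^{-1}$,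 where $\mathcal{S}_x$ applies $\sigma_x$ pointwise to paths; (iii) $\mathbb{P}_a(\mathcal{T}_t^{-1}(\mathcal{A}))=\mathbb{E}_a(\mathbb{P}_{\omega_t}(\mathcal{A}))$ for measurable $\mathcal{A}$, where $[\mathcal{T}_s\omega]_t=\omega_{t+s}$; (iv) $\int_\Omega\mathbb{P}_a(\omega_t\in A)\,d\mu(a)=\mu(A)$ for Borel $A$, $t>0$. Write $\mathbb{E}(\cdot)=\int_\Omega\mathbb{E}_a(\cdot)\,d\mu(a)$. The semigroup $S_tf(a)=\mathbb{E}_a(f(\omega_t))$ and its adjoint $S_t^\dagger$, given by $\int_\Omega g\,S_t^\dagger f\,d\mu=\mathbb{E}(g(\omega_t)f(\omega_0))$, are strongly continuous contraction semigroups on $L^2(\Omega)=L^2(\Omega,\mu)$. The generator is $Bf=\lim_{t\downarrow0}\frac1t(f-S_t^\dagger f)$ (so $S_t^\dagger=e^{-tB}$), with domain $\mathcal{D}(B)$ where the $L^2$-limit exists; $B1=B^\dagger1=0$. (A4) Gap and sectoriality: with $L^2_0(\Omega)=\{f\in L^2(\Omega):\int f\,d\mu=0\}$ and $\langle f,g\rangle=\int\bar f g\,d\mu$, there are $T>0$ and $b,q\in\mathbb{R}$ such that $\operatorname{Re}\langle f,Bf\rangle\ge\frac1T\|f\|_2^2$ and $|\operatorname{Im}\langle f,Bf\rangle|\le q\,|\operatorname{Re}\langle f,Bf\rangle+b|$ for all $f\in\mathcal{D}(B)\cap L^2_0(\Omega)$. In particular $B$ is invertible on $L_0^2(\Omega)$;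 this inverse is denoted $B^{-1}$. (A5) Potential: $v_x=v_0\circ\sigma_x$ with $v_0\in L^\infty(\mu)$ real valued, and there is $\chi>0$ with $\|B^{-1}(v_x-v_0)\|_{L^2(\Omega)}\ge\chi$ for all $x\in\mathbb{Z}^d$, $x\neq0$. *)

theory Defs
  imports "HOL-Probability.Probability"
begin

section \<open>Lattice, hopping and the Schroedinger equation\<close>

definition real_pt :: "int ^ 'd::finite \<Rightarrow> real ^ 'd" where
  "real_pt x = (\<chi> j. real_of_int (x $ j))"

definition complex_pt :: "int ^ 'd::finite \<Rightarrow> complex ^ 'd" where
  "complex_pt x = (\<chi> j. of_int (x $ j))"

definition l1_norm :: "int ^ 'd::finite \<Rightarrow> real" where
  "l1_norm x = (\<Sum>j\<in>UNIV. \<bar>real_of_int (x $ j)\<bar>)"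

text \<open>Bilinear, without conjugation (unlike an inner product on complex vectors).\<close>

definition cdot :: "complex ^ 'd::finite \<Rightarrow> complex ^ 'd \<Rightarrow> complex" where
  "cdot z w = (\<Sum>j\<in>UNIV. z $ j * w $ j)"

definition complex_mat :: "real ^ 'd ^ 'd \<Rightarrow> complex ^ 'd ^ 'd::finite" where
  "complex_mat D = (\<chi> i j. complex_of_real (D $ i $ j))"

definition positive_definite :: "real ^ 'd ^ 'd::finite \<Rightarrow> bool" where
  "positive_definite D \<longleftrightarrow> transpose D = D \<and> (\<forall>x. x \<noteq> 0 \<longrightarrow> x \<bullet> (D *v x) > 0)"

definition ell2 :: "('a \<Rightarrow> complex) set" where
  "ell2 = {\<psi>. (\<lambda>x. (cmod (\<psi> x))\<^sup>2) summable_on UNIV}"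

definition ell2_norm :: "('a \<Rightarrow> complex) \<Rightarrow> real" where
  "ell2_norm \<psi> = sqrt (\<Sum>\<^sub>\<infinity>x. (cmod (\<psi> x))\<^sup>2)"

definition exp_localized :: "(int ^ 'd::finite \<Rightarrow> complex) \<Rightarrow> bool" where
  "exp_localized \<psi> \<longleftrightarrow>
     (\<exists>\<kappa>>0. bdd_above (range (\<lambda>x. exp (\<kappa> * l1_norm x) * cmod (\<psi> x))))"

definition hopping_kernel :: "(int ^ 'd::finite \<Rightarrow> complex) \<Rightarrow> bool" where
  "hopping_kernel h \<longleftrightarrow>
     (\<forall>\<zeta>. h \<zeta> = cnj (h (- \<zeta>))) \<and>
     (\<exists>m>0. (\<lambda>y. exp (m * l1_norm y) * cmod (h y)) summable_on UNIV) \<and>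
     (\<forall>k::real ^ 'd. k \<noteq> 0 \<longrightarrow> (\<exists>y. k \<bullet> real_pt y \<noteq> 0 \<and> h y \<noteq> 0))"

definition hop :: "(int ^ 'd::finite \<Rightarrow> complex) \<Rightarrow> (int ^ 'd \<Rightarrow> complex) \<Rightarrow> int ^ 'd \<Rightarrow> complex" where
  "hop h \<psi> x = (\<Sum>\<^sub>\<infinity>y. h (x - y) * \<psi> y)"

text \<open>Solutions of \<open>i \<partial>\<^sub>t \<psi>\<^sub>t(x) = K \<psi>\<^sub>t(x) + V\<^sub>x(t) \<psi>\<^sub>t(x)\<close> that are continuous from \<open>[0,\<infinity>)\<close> to
  \<open>\<ell>\<^sup>2\<close>. Here \<open>V\<close> is only measurable and bounded in time, so the equation is read in integrated form.
  Such a solution is unique on \<open>[0,\<infinity>)\<close>; its values at negative times are irrelevant.\<close>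

definition schroedinger_solution ::
  "(int ^ 'd::finite \<Rightarrow> complex) \<Rightarrow> (int ^ 'd \<Rightarrow> real \<Rightarrow> real) \<Rightarrow> (int ^ 'd \<Rightarrow> complex) \<Rightarrow>
   (real \<Rightarrow> int ^ 'd \<Rightarrow> complex) \<Rightarrow> bool" where
  "schroedinger_solution h V \<psi>0 \<psi> \<longleftrightarrow>
     \<psi> 0 = \<psi>0 \<and>
     (\<forall>t\<ge>0. \<psi> t \<in> ell2) \<and>
     (\<forall>t\<ge>0. ((\<lambda>s. ell2_norm (\<lambda>x. \<psi> s x - \<psi> t x)) \<longlongrightarrow> 0) (at t within {0..})) \<and>
     (\<forall>x. \<forall>t\<ge>0.
        set_integrable lborel {0..t} (\<lambda>s. hop h (\<psi> s) x + of_real (V x s) * \<psi> s x) \<and>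
        \<i> * (\<psi> t x - \<psi>0 x) = (LINT s:{0..t}|lborel. hop h (\<psi> s) x + of_real (V x s) * \<psi> s x))"

definition wave ::
  "(int ^ 'd::finite \<Rightarrow> complex) \<Rightarrow> (int ^ 'd \<Rightarrow> real \<Rightarrow> real) \<Rightarrow> (int ^ 'd \<Rightarrow> complex) \<Rightarrow>
   real \<Rightarrow> int ^ 'd \<Rightarrow> complex" where
  "wave h V \<psi>0 = (SOME \<psi>. schroedinger_solution h V \<psi>0 \<psi>)"

section \<open>The Hilbert space of square integrable functions\<close>

text \<open>Elements of \<open>L\<^sup>2(\<mu>)\<close> are represented by functions; equality is almost everywhere equality.\<close>

definition L2 :: "'w measure \<Rightarrow> ('w \<Rightarrow> complex) set" where
  "L2 \<mu> = {f \<in> borel_measurable \<mu>. integrable \<mu> (\<lambda>a. (cmod (f a))\<^sup>2)}"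

definition L2_norm :: "'w measure \<Rightarrow> ('w \<Rightarrow> complex) \<Rightarrow> real" where
  "L2_norm \<mu> f = sqrt (\<integral>a. (cmod (f a))\<^sup>2 \<partial>\<mu>)"

definition L2_inner :: "'w measure \<Rightarrow> ('w \<Rightarrow> complex) \<Rightarrow> ('w \<Rightarrow> complex) \<Rightarrow> complex" where
  "L2_inner \<mu> f g = (\<integral>a. cnj (f a) * g a \<partial>\<mu>)"

definition L2_mean_zero :: "'w measure \<Rightarrow> ('w \<Rightarrow> complex) set" where
  "L2_mean_zero \<mu> = {f \<in> L2 \<mu>. (\<integral>a. f a \<partial>\<mu>) = 0}"

definition contraction_semigroup ::
  "'w measure \<Rightarrow> (real \<Rightarrow> ('w \<Rightarrow> complex) \<Rightarrow> 'w \<Rightarrow> complex) \<Rightarrow> bool" where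
  "contraction_semigroup \<mu> S \<longleftrightarrow>
     (\<forall>t\<ge>0. \<forall>f\<in>L2 \<mu>. S t f \<in> L2 \<mu> \<and> L2_norm \<mu> (S t f) \<le> L2_norm \<mu> f) \<and>
     (\<forall>t\<ge>0. \<forall>f\<in>L2 \<mu>. \<forall>g\<in>L2 \<mu>. \<forall>c. AE a in \<mu>. S t (\<lambda>b. f b + c * g b) a = S t f a + c * S t g a) \<and>
     (\<forall>f\<in>L2 \<mu>. AE a in \<mu>. S 0 f a = f a) \<and>
     (\<forall>s\<ge>0. \<forall>t\<ge>0. \<forall>f\<in>L2 \<mu>. AE a in \<mu>. S (s + t) f a = S s (S t f) a) \<and>
     (\<forall>f\<in>L2 \<mu>. ((\<lambda>t. L2_norm \<mu> (\<lambda>a. S t f a - f a)) \<longlongrightarrow> 0) (at_right 0))"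

text \<open>The relation \<open>f \<in> \<D>(B) \<and> Bf = u\<close> with the sign convention \<open>S\<^sub>t = e\<^sup>-\<^sup>t\<^sup>B\<close>.\<close>

definition L2_generator ::
  "'w measure \<Rightarrow> (real \<Rightarrow> ('w \<Rightarrow> complex) \<Rightarrow> 'w \<Rightarrow> complex) \<Rightarrow>
   ('w \<Rightarrow> complex) \<Rightarrow> ('w \<Rightarrow> complex) \<Rightarrow> bool" where
  "L2_generator \<mu> S f u \<longleftrightarrow>
     f \<in> L2 \<mu> \<and> u \<in> L2 \<mu> \<and>
     ((\<lambda>t. L2_norm \<mu> (\<lambda>a. (f a - S t f a) / of_real t - u a)) \<longlongrightarrow> 0) (at_right 0)"

definition generator_inverse ::
  "'w measure \<Rightarrow> (real \<Rightarrow> ('w \<Rightarrow> complex) \<Rightarrow> 'w \<Rightarrow> complex) \<Rightarrow> ('w \<Rightarrow> complex) \<Rightarrow> 'w \<Rightarrow> complex" where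
  "generator_inverse \<mu> S g = (SOME f. f \<in> L2_mean_zero \<mu> \<and> L2_generator \<mu> S f g)"

section \<open>The Markov process\<close>

definition measure_preserving_shifts ::
  "'w::topological_space measure \<Rightarrow> (int ^ 'd::finite \<Rightarrow> 'w \<Rightarrow> 'w) \<Rightarrow> bool" where
  "measure_preserving_shifts \<mu> \<sigma> \<longleftrightarrow>
     prob_space \<mu> \<and> sets \<mu> = sets borel \<and>
     (\<forall>x. \<sigma> x \<in> \<mu> \<rightarrow>\<^sub>M \<mu> \<and> distr \<mu> \<mu> (\<sigma> x) = \<mu>) \<and>
     \<sigma> 0 = id \<and> (\<forall>x y. \<sigma> x \<circ> \<sigma> y = \<sigma> (x + y))"

text \<open>All paths \<open>[0,\<infinity>) \<rightarrow> \<Omega>\<close> (as functions on \<open>real\<close> that are \<open>undefined\<close> at negative times), with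
  the cylinder \<open>\<sigma>\<close>-algebra.\<close>

definition path_algebra :: "(real \<Rightarrow> 'w::topological_space) measure" where
  "path_algebra = (\<Pi>\<^sub>M t\<in>{0..}. borel)"

definition rc_paths :: "(real \<Rightarrow> 'w::topological_space) set" where
  "rc_paths = {\<omega> \<in> space path_algebra. \<forall>t\<ge>0. (\<omega> \<longlongrightarrow> \<omega> t) (at_right t)}"

definition path_shift :: "('w \<Rightarrow> 'w) \<Rightarrow> (real \<Rightarrow> 'w) \<Rightarrow> real \<Rightarrow> 'w" where
  "path_shift s \<omega> = (\<lambda>t\<in>{0..}. s (\<omega> t))"

definition time_shift :: "real \<Rightarrow> (real \<Rightarrow> 'w) \<Rightarrow> real \<Rightarrow> 'w" where
  "time_shift s \<omega> = (\<lambda>t\<in>{0..}. \<omega> (t + s))"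

text \<open>The set of right continuous paths is not an event of the cylinder \<open>\<sigma>\<close>-algebra, and in general
  it contains no event of probability one, since a cylinder event only depends on countably many
  coordinates. As usual, a process has almost surely right continuous paths if the set of these paths
  has outer probability one. Functionals that only make sense for right continuous paths are
  integrated with respect to the trace of the path measure on that set.\<close>

definition trace_measure :: "'a measure \<Rightarrow> 'a set \<Rightarrow> 'a measure" where
  "trace_measure M R = measure_of (R \<inter> space M) ((\<inter>) R ` sets M) (outer_measure_of M)"

lemma outer_measure_of_trace:
  assumes "prob_space M" "outer_measure_of M R = 1" "A \<in> sets M"
  shows "outer_measure_of M (R \<inter> A) = emeasure M A"
proof (rule antisym)
  interpret prob_space M by fact
  show "outer_measure_of M (R \<inter> A) \<le> emeasure M A"
    using assms(3) by (metis inf_le2 outer_measure_of_eq outer_measure_of_mono)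
  show "emeasure M A \<le> outer_measure_of M (R \<inter> A)"
    unfolding outer_measure_of_def
  proof (rule INF_greatest)
    fix B assume "B \<in> {B \<in> sets M. R \<inter> A \<subseteq> B}"
    then have B: "B \<in> sets M" "R \<inter> A \<subseteq> B" by auto
    have R: "R \<subseteq> space M"
    proof (rule ccontr)
      assume "\<not> R \<subseteq> space M"
      then have "{B \<in> sets M. R \<subseteq> B} = {}" using sets.sets_into_space by blast
      then have "outer_measure_of M R = top" unfolding outer_measure_of_def by (metis INF_empty)
      with assms(2) show False by simp
    qed
    have "1 \<le> emeasure M (space M - (A - B))"
      unfolding assms(2)[symmetric] outer_measure_of_def
      using R B assms(3) by (intro INF_lower) auto
    then have "1 \<le> prob (space M - (A - B))" by (simp add: emeasure_eq_measure)
    moreover have "prob (space M - (A - B)) = 1 - prob (A - B)"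
      using B assms(3) by (intro prob_compl) auto
    ultimately have "prob (A - B) = 0" using measure_nonneg[of M "A - B"] by linarith
    then have "prob A = prob (A \<inter> B)"
      using finite_measure_Diff'[of A B] B assms(3) by simp
    also have "\<dots> \<le> prob B" using B by (intro finite_measure_mono) auto
    finally show "emeasure M A \<le> emeasure M B" by (simp add: emeasure_eq_measure)
  qed
qed

lemma sets_trace_measure: "sets (trace_measure M R) = (\<inter>) R ` sets M"
  and space_trace_measure: "space (trace_measure M R) = R \<inter> space M"
proof -
  have "sigma_algebra (R \<inter> space M) ((\<inter>) R ` sets M)"
    by (metis sets.sigma_algebra_axioms sets_restrict_space space_restrict_space)
  then show "sets (trace_measure M R) = (\<inter>) R ` sets M"
    unfolding trace_measure_def by (rule sigma_algebra.sets_measure_of_eq)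
  show "space (trace_measure M R) = R \<inter> space M"
    unfolding trace_measure_def by (rule space_measure_of) (auto dest: sets.sets_into_space)
qed

lemma emeasure_trace_measure:
  assumes "prob_space M" "outer_measure_of M R = 1" "A \<in> sets M"
  shows "emeasure (trace_measure M R) (R \<inter> A) = emeasure M A"
proof -
  note trace = outer_measure_of_trace[OF assms(1,2)]
  have "emeasure (trace_measure M R) (R \<inter> A) = outer_measure_of M (R \<inter> A)"
  proof (rule emeasure_measure_of[OF trace_measure_def])
    show "(\<inter>) R ` sets M \<subseteq> Pow (R \<inter> space M)" by (auto dest: sets.sets_into_space)
    show "R \<inter> A \<in> sets (trace_measure M R)" using assms(3) by (simp add: sets_trace_measure)
    show "positive (sets (trace_measure M R)) (outer_measure_of M)" by (simp add: positive_def)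
    show "countably_additive (sets (trace_measure M R)) (outer_measure_of M)"
    proof (rule countably_additiveI)
      fix F :: "nat \<Rightarrow> _"
      assume F: "range F \<subseteq> sets (trace_measure M R)" "disjoint_family F"
      then have "\<forall>i. \<exists>G\<in>sets M. F i = R \<inter> G" by (auto simp: sets_trace_measure)
      then obtain G where G: "\<And>i. G i \<in> sets M" "\<And>i. F i = R \<inter> G i" by metis
      have dG: "\<And>i. disjointed G i \<in> sets M"
        using G(1) sets.range_disjointed_sets[of G M] by auto
      have eq: "F i = R \<inter> disjointed G i" for i
      proof -
        have "R \<inter> G i \<inter> G j = {}" if "j \<noteq> i" for j
          using F(2) that G(2)[of i] G(2)[of j] unfolding disjoint_family_on_def by blast
        then show ?thesis unfolding G(2)[of i] disjointed_def by fastforce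
      qed
      have "(\<Sum>i. outer_measure_of M (F i)) = (\<Sum>i. emeasure M (disjointed G i))"
        using trace[OF dG] eq by simp
      also have "\<dots> = emeasure M (\<Union>i. disjointed G i)"
        using dG by (intro suminf_emeasure disjoint_family_disjointed) auto
      also have "\<dots> = outer_measure_of M (R \<inter> (\<Union>i. disjointed G i))"
        using dG by (intro trace[symmetric] sets.countable_UN) auto
      also have "R \<inter> (\<Union>i. disjointed G i) = (\<Union>i. F i)" using eq by auto
      finally show "(\<Sum>i. outer_measure_of M (F i)) = outer_measure_of M (\<Union>i. F i)" .
    qed
  qed
  with trace[OF assms(3)] show ?thesis by simp
qed

definition semigroup_of ::
  "('w \<Rightarrow> (real \<Rightarrow> 'w) measure) \<Rightarrow> real \<Rightarrow> ('w \<Rightarrow> complex) \<Rightarrow> 'w \<Rightarrow> complex" where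
  "semigroup_of P t f a = (\<integral>\<omega>. f (\<omega> t) \<partial>P a)"

definition adjoint_semigroup ::
  "'w measure \<Rightarrow> ('w \<Rightarrow> (real \<Rightarrow> 'w) measure) \<Rightarrow> real \<Rightarrow> ('w \<Rightarrow> complex) \<Rightarrow> 'w \<Rightarrow> complex" where
  "adjoint_semigroup \<mu> P t f = (SOME u. u \<in> L2 \<mu> \<and>
     (\<forall>g\<in>L2 \<mu>. (\<integral>a. g a * u a \<partial>\<mu>) = (\<integral>a. (\<integral>\<omega>. g (\<omega> t) * f (\<omega> 0) \<partial>P a) \<partial>\<mu>)))"

text \<open>Membership of \<open>P\<close> in the first set says that every \<open>P a\<close> is a probability measure on the path
  space and that \<open>a \<mapsto> P a A\<close> is Borel measurable for each event \<open>A\<close>; the latter is needed for the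
  integrals in the Markov property and in the invariance of \<open>\<mu>\<close> to make sense.\<close>

definition markov_process ::
  "'w::topological_space measure \<Rightarrow> (int ^ 'd::finite \<Rightarrow> 'w \<Rightarrow> 'w) \<Rightarrow> ('w \<Rightarrow> (real \<Rightarrow> 'w) measure) \<Rightarrow> bool" where
  "markov_process \<mu> \<sigma> P \<longleftrightarrow>
     P \<in> borel \<rightarrow>\<^sub>M prob_algebra path_algebra \<and>
     (\<forall>a. outer_measure_of (P a) {\<omega> \<in> rc_paths. \<omega> 0 = a} = 1) \<and>
     (\<forall>x a. P (\<sigma> x a) = distr (P a) path_algebra (path_shift (\<sigma> x))) \<and>
     (\<forall>a. \<forall>t\<ge>0. \<forall>A\<in>sets path_algebra.
        measure (P a) (time_shift t -` A \<inter> space path_algebra) = (\<integral>\<omega>. measure (P (\<omega> t)) A \<partial>P a)) \<and>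
     (\<forall>t>0. \<forall>A\<in>sets borel.
        (\<integral>a. measure (P a) {\<omega> \<in> space path_algebra. \<omega> t \<in> A} \<partial>\<mu>) = measure \<mu> A) \<and>
     contraction_semigroup \<mu> (semigroup_of P) \<and>
     contraction_semigroup \<mu> (adjoint_semigroup \<mu> P) \<and>
     L2_generator \<mu> (semigroup_of P) (\<lambda>_. 1) (\<lambda>_. 0) \<and>
     L2_generator \<mu> (adjoint_semigroup \<mu> P) (\<lambda>_. 1) (\<lambda>_. 0)"

definition gap_sectorial ::
  "'w measure \<Rightarrow> ('w \<Rightarrow> (real \<Rightarrow> 'w) measure) \<Rightarrow> bool" where
  "gap_sectorial \<mu> P \<longleftrightarrow>
     (\<exists>T>0. \<exists>b q :: real. \<forall>f u.
        f \<in> L2_mean_zero \<mu> \<and> L2_generator \<mu> (adjoint_semigroup \<mu> P) f u \<longrightarrow>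
          Re (L2_inner \<mu> f u) \<ge> 1 / T * (L2_norm \<mu> f)\<^sup>2 \<and>
          \<bar>Im (L2_inner \<mu> f u)\<bar> \<le> q * \<bar>Re (L2_inner \<mu> f u) + b\<bar>)"

definition nondegenerate_potential ::
  "'w::topological_space measure \<Rightarrow> (int ^ 'd::finite \<Rightarrow> 'w \<Rightarrow> 'w) \<Rightarrow> ('w \<Rightarrow> (real \<Rightarrow> 'w) measure) \<Rightarrow>
   ('w \<Rightarrow> real) \<Rightarrow> bool" where
  "nondegenerate_potential \<mu> \<sigma> P v0 \<longleftrightarrow>
     v0 \<in> borel_measurable borel \<and> (\<exists>C. AE a in \<mu>. \<bar>v0 a\<bar> \<le> C) \<and>
     (\<exists>c>0. \<forall>x. x \<noteq> 0 \<longrightarrow>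
        L2_norm \<mu> (generator_inverse \<mu> (adjoint_semigroup \<mu> P)
          (\<lambda>a. of_real (v0 (\<sigma> x a) - v0 a))) \<ge> c)"

text \<open>The mean density \<open>\<E>(\<bar>\<psi>\<^sub>t(x)\<bar>\<^sup>2)\<close>, where \<open>\<E>\<close> averages over paths started in \<open>a\<close> and then over \<open>a\<close>.\<close>

definition mean_density ::
  "(int ^ 'd::finite \<Rightarrow> complex) \<Rightarrow> 'w::topological_space measure \<Rightarrow> (int ^ 'd \<Rightarrow> 'w \<Rightarrow> 'w) \<Rightarrow>
   ('w \<Rightarrow> (real \<Rightarrow> 'w) measure) \<Rightarrow> ('w \<Rightarrow> real) \<Rightarrow> (int ^ 'd \<Rightarrow> complex) \<Rightarrow> real \<Rightarrow> int ^ 'd \<Rightarrow> real" where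
  "mean_density h \<mu> \<sigma> P v0 \<psi>0 t x =
     enn2real (\<integral>\<^sup>+a. (\<integral>\<^sup>+\<omega>. ennreal ((cmod (wave h (\<lambda>y s. v0 (\<sigma> y (\<omega> s))) \<psi>0 t x))\<^sup>2)
       \<partial>trace_measure (P a) rc_paths) \<partial>\<mu>)"

section \<open>Diffusion matrix and test functions\<close>

definition diffusion_matrix ::
  "(int ^ 'd::finite \<Rightarrow> complex) \<Rightarrow> 'w::topological_space measure \<Rightarrow> (int ^ 'd \<Rightarrow> 'w \<Rightarrow> 'w) \<Rightarrow>
   ('w \<Rightarrow> (real \<Rightarrow> 'w) measure) \<Rightarrow> ('w \<Rightarrow> real) \<Rightarrow> real ^ 'd ^ 'd \<Rightarrow> bool" where
  "diffusion_matrix h \<mu> \<sigma> P v0 D \<longleftrightarrow>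
     positive_definite D \<and>
     (\<forall>\<psi>0 t Z. \<psi>0 \<in> ell2 \<and> exp_localized \<psi>0 \<and> t > 0 \<and> compact Z \<longrightarrow>
        uniform_limit Z
          (\<lambda>\<tau> z. \<Sum>\<^sub>\<infinity>x. exp (\<i> * cdot z (complex_pt x) / of_real (sqrt \<tau>))
                        * of_real (mean_density h \<mu> \<sigma> P v0 \<psi>0 (\<tau> * t) x))
          (\<lambda>z. of_real ((ell2_norm \<psi>0)\<^sup>2) * exp (- of_real t / 2 * cdot z (complex_mat D *v z)))
          at_top)"

definition polynomially_bounded :: "('a::real_normed_vector \<Rightarrow> real) \<Rightarrow> bool" where
  "polynomially_bounded f \<longleftrightarrow> (\<exists>C. \<exists>n::nat. \<forall>x. \<bar>f x\<bar> \<le> C * (1 + norm x) ^ n)"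

definition gaussian_density :: "real ^ 'd ^ 'd \<Rightarrow> real ^ 'd::finite \<Rightarrow> real" where
  "gaussian_density D x =
     1 / sqrt ((2 * pi) ^ CARD('d) * det D) * exp (- (1 / 2) * (x \<bullet> (matrix_inv D *v x)))"

end

theory Submission
  imports Defs
begin

text \<open>The rescaled densities are measures whose Laplace and Fourier transforms converge to those of a Gaussian.
  Convergence for all complex frequencies gives weights such as \<open>\<Sum>\<^sub>j exp x\<^sub>j + exp (- x\<^sub>j)\<close> with convergent,
  hence bounded, integrals. A polynomially bounded continuous \<open>f\<close> differs from a suitable trigonometric
  polynomial by at most \<open>\<epsilon>\<close> times such a weight, so that convergence passes from exponentials to \<open>f\<close>.
  Summability for large times comes from the fact that the limit is nonzero; for \<open>\<psi>\<^sub>0 = 0\<close> it comes from the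
  uniqueness of solutions of the Schroedinger equation. The powers \<open>\<bar>x\<bar>\<^sup>p\<close> are a special case of \<open>f\<close>.\<close>

section \<open>Linear change of variables and Gaussian integrals\<close>

text \<open>Real frequencies alone would give weak convergence, which does not control unbounded
  observables. Imaginary frequencies give exponential moments, and these dominate every polynomial.
  They also replace a separate tightness argument, because the approximation error is measured by
  the weight on the whole space and not only on a compact set. The limit in
  \<open>diffusion_matrix\<close> is a closed formula in \<open>z\<close>. To read it as an integral
  against \<open>gaussian_density D\<close>, the Gaussian transform is needed for complex
  \<open>z\<close> and a general positive definite \<open>D\<close>. Writing D = A A^T and
  substituting x = A y reduces it to a product of one-dimensional integrals, which is the purpose of
  the linear change of variables. Uniqueness for the Schroedinger equation has to be proved because
  \<open>wave\<close> is merely some chosen solution: zero initial data do not by definition give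
  the zero wave.\<close>

lemma measurable_vec_lambda_lborel: "(\<lambda>f. \<chi> i. f i) \<in> (\<Pi>\<^sub>M i\<in>(UNIV::'d::finite set). (lborel::real measure)) \<rightarrow>\<^sub>M (borel :: (real ^ 'd) measure)"
proof (subst borel_measurable_euclidean_space, rule ballI)
  fix b :: "real ^ 'd" assume "b \<in> Basis"
  then obtain i where b: "b = axis i 1"
    by (auto simp: Basis_vec_def)
  show "(\<lambda>f. (\<chi> i. f i) \<bullet> b) \<in> borel_measurable (\<Pi>\<^sub>M i\<in>(UNIV::'d set). (lborel::real measure))"
    by (simp add: b inner_axis)
qed

text \<open>Gives access to Fubini in single coordinates, both for shears and for products of
  one-dimensional Gaussians. Lebesgue measure is determined by its values on boxes, where both sides
  are products of side lengths.\<close>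

lemma lborel_vec_eq:
  "(lborel :: (real ^ 'd::finite) measure) = distr (\<Pi>\<^sub>M i\<in>(UNIV::'d set). lborel) borel (\<lambda>f. \<chi> i. f i)"
proof (rule lborel_eqI)
  interpret product_sigma_finite "\<lambda>_::'d. lborel :: real measure" ..
  fix l u :: "real ^ 'd" assume lu: "\<And>b. b \<in> Basis \<Longrightarrow> l \<bullet> b \<le> u \<bullet> b"
  then have lu': "l $ i \<le> u $ i" for i
    by (metis axis_in_Basis_iff cart_eq_inner_axis insertI1 Basis_real_def)
  have *: "(\<lambda>f. \<chi> i. f i) -` box l u \<inter> space (\<Pi>\<^sub>M i\<in>(UNIV::'d set). (lborel::real measure)) = (\<Pi>\<^sub>E i\<in>UNIV. {l $ i<..<u $ i})"
    by (auto simp: space_PiM mem_box_cart PiE_def Pi_def)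
  have "emeasure (distr (\<Pi>\<^sub>M i\<in>(UNIV::'d set). lborel) borel (\<lambda>f. \<chi> i. f i)) (box l u)
      = (\<Prod>i\<in>UNIV. emeasure lborel {l $ i<..<u $ i})"
    by (simp add: emeasure_distr measurable_vec_lambda_lborel * emeasure_PiM)
  also have "\<dots> = ennreal (\<Prod>i\<in>UNIV. (u - l) $ i)"
    using lu' by (simp add: prod_ennreal)
  also have "(\<Prod>i\<in>UNIV. (u - l) $ i) = (\<Prod>b\<in>Basis. (u - l) \<bullet> b)"
    by (simp add: Basis_vec_def cart_eq_inner_axis inj_on_def axis_eq_axis UNION_singleton_eq_range prod.reindex)
  finally show "emeasure (distr (\<Pi>\<^sub>M i\<in>(UNIV::'d set). lborel) borel (\<lambda>f. \<chi> i. f i)) (box l u) =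
      ennreal (\<Prod>b\<in>Basis. (u - l) \<bullet> b)" .
qed simp

lemma borel_measurable_matrix_vector_mult [measurable]:
  "(\<lambda>x. A *v x) \<in> borel_measurable (borel :: (real ^ 'd::finite) measure)" for A :: "real ^ 'd ^ 'd"
  by (intro borel_measurable_continuous_onI linear_continuous_on) 
     (simp add: linear_conv_bounded_linear[symmetric] matrix_vector_mul_linear)

text \<open>The change of variables formulas of the library need a well-ordered index type.\<close>

lemma nn_integral_lborel_matrix:
  fixes A :: "real ^ 'd ^ 'd::finite"
  assumes "det A \<noteq> 0" "g \<in> borel_measurable borel"
  shows "(\<integral>\<^sup>+x. g x \<partial>lborel) = ennreal \<bar>det A\<bar> * (\<integral>\<^sup>+x. g (A *v x) \<partial>lborel)"
  using assms
\<comment> \<open>Every matrix is a product of matrices with a zero row (excluded here by the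
  determinant), diagonal matrices, coordinate swaps and shears. \<open>g\<close> is generalised
  because a product A B needs the hypothesis for B at \<open>g\<close> composed with A.\<close>
proof (induction A arbitrary: g rule: induct_matrix_elementary)
  case (1 A B)
  have d: "det A \<noteq> 0" "det B \<noteq> 0" using "1.prems" by (auto simp: det_mul)
  have m: "(\<lambda>x. g (A *v x)) \<in> borel_measurable borel"
    using "1.prems" by measurable
  show ?case
    by (simp add: "1.IH"(1)[OF d(1) "1.prems"(2)] "1.IH"(2)[OF d(2) m] det_mul abs_mult ennreal_mult
        matrix_vector_mul_assoc mult.assoc)
next
  case (2 A i)
  then show ?case by (simp add: det_zero_row(2))
next
  case (3 A)
  have d: "det A = (\<Prod>i\<in>UNIV. A $ i $ i)"
    using 3 by (intro det_diagonal) auto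
  have nz: "A $ i $ i \<noteq> 0" for i
    using 3(2) unfolding d by auto
  \<comment> \<open>The affine formula indexes its scaling factors by \<open>Basis\<close>; on
    \<open>axis i 1\<close> the function \<open>c\<close> returns the i-th diagonal entry.\<close>
  define c where "c b = (\<Sum>i\<in>UNIV. A $ i $ i * b $ i)" for b :: "real ^ 'd"
  have cax: "c (axis i 1) = A $ i $ i" for i
    by (simp add: c_def axis_def if_distrib cong: if_cong)
  have cne: "c b \<noteq> 0" if "b \<in> Basis" for b
    using that nz by (auto simp: Basis_vec_def cax)
  have pr: "(\<Prod>b\<in>Basis. \<bar>c b\<bar>) = \<bar>det A\<bar>"
    by (simp add: Basis_vec_def inj_on_def axis_eq_axis UNION_singleton_eq_range prod.reindex cax d abs_prod)
  have Av: "(\<Sum>j\<in>Basis. (c j * (x \<bullet> j)) *\<^sub>R j) = A *v x" for x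
  proof -
    have "(\<Sum>j\<in>Basis. (c j * (x \<bullet> j)) *\<^sub>R j) = (\<Sum>i\<in>UNIV. (A $ i $ i * x $ i) *\<^sub>R axis i 1)"
      by (simp add: Basis_vec_def inj_on_def axis_eq_axis UNION_singleton_eq_range sum.reindex cax inner_axis)
    also have "\<dots> = A *v x"
    proof -
      have "(\<Sum>i\<in>UNIV. (A $ i $ i * x $ i) *\<^sub>R axis i 1) $ k = (A *v x) $ k" for k
      proof -
        have "(A *v x) $ k = A $ k $ k * x $ k + (\<Sum>j\<in>UNIV - {k}. A $ k $ j * x $ j)"
          by (simp add: matrix_vector_mult_def sum.remove[of UNIV k])
        also have "(\<Sum>j\<in>UNIV - {k}. A $ k $ j * x $ j) = 0"
          using 3(1) by (intro sum.neutral) auto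
        finally show ?thesis
          by (simp add: axis_def if_distrib cong: if_cong)
      qed
      then show ?thesis by (simp add: vec_eq_iff)
    qed
    finally show ?thesis .
  qed
  have "(\<integral>\<^sup>+x. g x \<partial>lborel) = ennreal \<bar>det A\<bar> * (\<integral>\<^sup>+x. g x \<partial>distr lborel borel (\<lambda>x. A *v x))"
    using 3(3)
    by (subst lborel_affine_euclidean[OF cne, of "\<lambda>b. b" 0]) 
       (simp_all add: Av pr nn_integral_density nn_integral_cmult)
  then show ?case using 3(3) by (simp add: nn_integral_distr)
next
  case (4 m n)
  let ?S = "\<chi> i j. mat 1 $ i $ Transposition.transpose m n j :: real ^ 'd ^ 'd"
  have p: "Transposition.transpose m n permutes (UNIV :: 'd set)" by (simp add: permutes_swap_id)
  have "det ?S = of_int (sign (Transposition.transpose m n)) * det (mat 1 :: real ^ 'd ^ 'd)"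
    by (rule det_permute_columns[OF p])
  then have det: "\<bar>det ?S\<bar> = 1" by (simp add: sign_swap_id)
  have Sv: "?S *v x = (\<chi> i. x $ Transposition.transpose m n i)" for x
  proof -
    have "(\<Sum>j\<in>UNIV. mat 1 $ i $ Transposition.transpose m n j * x $ j)
        = (\<Sum>j\<in>UNIV. if j = Transposition.transpose m n i then x $ j else 0)" for i
      by (intro sum.cong) (auto simp: mat_def)
    then show ?thesis by (simp add: vec_eq_iff matrix_vector_mult_def)
  qed
  have "(lborel :: (real ^ 'd) measure) = distr lborel borel (\<lambda>x. ?S *v x)"
  proof (rule lborel_eqI)
    fix l u :: "real ^ 'd" assume lu: "\<And>b. b \<in> Basis \<Longrightarrow> l \<bullet> b \<le> u \<bullet> b"
    have lu': "l $ i \<le> u $ i" for i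
      using lu[of "axis i 1"] by (simp add: inner_axis axis_in_Basis_iff)
    \<comment> \<open>A swap is an involution, so the preimage of a box is the box whose corners are
      swapped.\<close>
    have *: "(\<lambda>x. ?S *v x) -` box l u = box (?S *v l) (?S *v u)"
      unfolding Sv by (auto simp: mem_box_cart) (metis transpose_involutory)+
    have "emeasure (distr lborel borel (\<lambda>x. ?S *v x)) (box l u) = emeasure lborel (box (?S *v l) (?S *v u))"
      using * by (simp add: emeasure_distr)
    also have "\<dots> = ennreal (\<Prod>b\<in>Basis. (?S *v u - ?S *v l) \<bullet> b)"
      by (rule emeasure_lborel_box) (use lu' in \<open>auto simp: Sv Basis_vec_def inner_axis\<close>)
    also have "(\<Prod>b\<in>Basis. (?S *v u - ?S *v l) \<bullet> b) = (\<Prod>i\<in>UNIV. (u - l) $ Transposition.transpose m n i)"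
      by (simp add: Basis_vec_def inj_on_def axis_eq_axis UNION_singleton_eq_range prod.reindex inner_axis Sv)
    also have "\<dots> = (\<Prod>i\<in>UNIV. (u - l) $ i)"
      by (rule prod.permute[OF p, unfolded o_def, symmetric])
    also have "\<dots> = (\<Prod>b\<in>Basis. (u - l) \<bullet> b)"
      by (simp add: Basis_vec_def inj_on_def axis_eq_axis UNION_singleton_eq_range prod.reindex inner_axis)
    finally show "emeasure (distr lborel borel (\<lambda>x. ?S *v x)) (box l u) = ennreal (\<Prod>b\<in>Basis. (u - l) \<bullet> b)" .
  qed simp
  then have "(\<integral>\<^sup>+x. g x \<partial>lborel) = (\<integral>\<^sup>+x. g x \<partial>distr lborel borel (\<lambda>x. ?S *v x))"
    by simp
  also have "\<dots> = (\<integral>\<^sup>+x. g (?S *v x) \<partial>lborel)"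
    using 4(3) by (simp add: nn_integral_distr)
  finally show ?case by (simp add: det)
next
  case (5 m n c)
  interpret product_sigma_finite "\<lambda>_::'d. lborel :: real measure" ..
  let ?T = "\<chi> i j. if i = m \<and> j = n then c else of_bool (i = j) :: real ^ 'd ^ 'd"
  have "?T = (\<chi> k. if k = m then row m (mat 1) + c *s row n (mat 1) else row k (mat 1))"
    using 5(1) by (auto simp: vec_eq_iff row_def mat_def)
  then have det: "det ?T = 1"
    using det_row_operation[OF 5(1), of "mat 1" c] by simp
  have Tv: "?T *v x = (\<chi> i. if i = m then x $ m + c * x $ n else x $ i)" for x
  proof -
    have "(\<Sum>j\<in>UNIV. (if i = m \<and> j = n then c else of_bool (i = j)) * x $ j) = (if i = m then x $ m + c * x $ n else x $ i)" for i
    proof (cases "i = m")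
      case True
      have "(\<Sum>j\<in>UNIV. (if i = m \<and> j = n then c else of_bool (i = j)) * x $ j)
         = (\<Sum>j\<in>UNIV. (if j = n then c * x $ n else 0) + (if j = m then x $ m else 0))"
        using 5(1) True by (intro sum.cong) auto
      then show ?thesis using True by (simp add: sum.distrib)
    next
      case False
      have "(\<Sum>j\<in>UNIV. (if i = m \<and> j = n then c else of_bool (i = j)) * x $ j) = (\<Sum>j\<in>UNIV. if j = i then x $ i else 0)"
        using False by (intro sum.cong) auto
      then show ?thesis using False by simp
    qed
    then show ?thesis by (simp add: vec_eq_iff matrix_vector_mult_def)
  qed
  have gm [measurable]: "g \<in> borel_measurable borel" by fact
  note measurable_vec_lambda_lborel[measurable]
  let ?I = "UNIV - {m}"
  have U: "(UNIV :: 'd set) = insert m ?I" by auto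
  \<comment> \<open>Coordinate \<open>m\<close> is integrated first, with the others fixed. On it
    the shear acts as translation by \<open>c * x n\<close>, which is constant because n differs
    from m, so one-dimensional translation invariance suffices.\<close>
  have split: "(\<integral>\<^sup>+x. f x \<partial>lborel) = (\<integral>\<^sup>+x. (\<integral>\<^sup>+y. f (\<chi> i. (x(m := y)) i) \<partial>lborel) \<partial>(\<Pi>\<^sub>M i\<in>?I. lborel))"
    if [measurable]: "f \<in> borel_measurable borel" for f :: "real ^ 'd \<Rightarrow> ennreal"
  proof -
    have "(\<integral>\<^sup>+x. f x \<partial>lborel) = (\<integral>\<^sup>+x. f (\<chi> i. x i) \<partial>(\<Pi>\<^sub>M i\<in>insert m ?I. lborel))"
      unfolding U[symmetric] by (subst lborel_vec_eq) (simp add: nn_integral_distr)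
    also have "\<dots> = (\<integral>\<^sup>+x. (\<integral>\<^sup>+y. f (\<chi> i. (x(m := y)) i) \<partial>lborel) \<partial>(\<Pi>\<^sub>M i\<in>?I. lborel))"
      by (rule product_nn_integral_insert) (auto simp flip: U)
    finally show ?thesis .
  qed
  have "(\<integral>\<^sup>+x. g (?T *v x) \<partial>lborel) = (\<integral>\<^sup>+x. (\<integral>\<^sup>+y. g (?T *v (\<chi> i. (x(m := y)) i)) \<partial>lborel) \<partial>(\<Pi>\<^sub>M i\<in>?I. lborel))"
    by (rule split) measurable
  also have "\<dots> = (\<integral>\<^sup>+x. (\<integral>\<^sup>+y. g (\<chi> i. (x(m := c * x n + 1 * y)) i) \<partial>lborel) \<partial>(\<Pi>\<^sub>M i\<in>?I. lborel))"
  proof (intro nn_integral_cong)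
    fix x y
    have "?T *v (\<chi> i. (x(m := y)) i) = (\<chi> i. (x(m := c * x n + 1 * y)) i)"
      unfolding Tv using 5(1) by (auto simp: vec_eq_iff)
    then show "g (?T *v (\<chi> i. (x(m := y)) i)) = g (\<chi> i. (x(m := c * x n + 1 * y)) i)" by simp
  qed
  also have "\<dots> = (\<integral>\<^sup>+x. (\<integral>\<^sup>+y. g (\<chi> i. (x(m := y)) i) \<partial>lborel) \<partial>(\<Pi>\<^sub>M i\<in>?I. lborel))"
  proof (rule nn_integral_cong)
    fix x assume x: "x \<in> space (\<Pi>\<^sub>M i\<in>?I. (lborel :: real measure))"
    have upd: "(\<lambda>y. x(m := y)) \<in> borel \<rightarrow>\<^sub>M (\<Pi>\<^sub>M i\<in>UNIV. lborel)"
      by (rule measurable_PiM_single') (auto simp: space_PiM)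
    have gx: "(\<lambda>y. g (\<chi> i. (x(m := y)) i)) \<in> borel_measurable borel"
      using measurable_compose[OF measurable_compose[OF upd measurable_vec_lambda_lborel] gm] by simp
    show "(\<integral>\<^sup>+y. g (\<chi> i. (x(m := c * x n + 1 * y)) i) \<partial>lborel) = (\<integral>\<^sup>+y. g (\<chi> i. (x(m := y)) i) \<partial>lborel)"
      using nn_integral_real_affine[OF gx, of 1 "c * x n"] by simp
  qed
  also have "\<dots> = (\<integral>\<^sup>+x. g x \<partial>lborel)"
    by (rule split[symmetric]) measurable
  finally show ?case by (simp add: det)
qed


text \<open>As an identity of measures, the formula for nonnegative integrands carries over to
  Banach space valued ones.\<close>

lemma lborel_matrix_eq:
  fixes A :: "real ^ 'd ^ 'd::finite"
  assumes "det A \<noteq> 0"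
  shows "lborel = density (distr lborel borel (\<lambda>x. A *v x)) (\<lambda>_. ennreal \<bar>det A\<bar>)"
proof (rule measure_eqI)
  fix X :: "(real ^ 'd) set" assume "X \<in> sets lborel"
  then have [measurable]: "X \<in> sets borel" by simp
  have "emeasure lborel X = (\<integral>\<^sup>+x. indicator X x \<partial>lborel)" by simp
  also have "\<dots> = ennreal \<bar>det A\<bar> * (\<integral>\<^sup>+x. indicator X (A *v x) \<partial>lborel)"
    by (rule nn_integral_lborel_matrix[OF assms]) measurable
  also have "\<dots> = (\<integral>\<^sup>+x. ennreal \<bar>det A\<bar> * indicator X x \<partial>distr lborel borel (\<lambda>x. A *v x))"
    by (subst nn_integral_distr) (measurable, simp add: nn_integral_cmult)
  also have "\<dots> = emeasure (density (distr lborel borel (\<lambda>x. A *v x)) (\<lambda>_. ennreal \<bar>det A\<bar>)) X"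
    by (simp add: emeasure_density)
  finally show "emeasure lborel X = emeasure (density (distr lborel borel (\<lambda>x. A *v x)) (\<lambda>_. ennreal \<bar>det A\<bar>)) X" .
qed simp

lemma has_bochner_integral_lborel_matrix:
  fixes A :: "real ^ 'd ^ 'd::finite" and g :: "real ^ 'd \<Rightarrow> 'b::{banach, second_countable_topology}"
  assumes "det A \<noteq> 0" and g [measurable]: "g \<in> borel_measurable borel"
    and "has_bochner_integral lborel (\<lambda>y. \<bar>det A\<bar> *\<^sub>R g (A *v y)) I"
  shows "has_bochner_integral lborel g I"
  using assms(3)
  by (subst lborel_matrix_eq[OF assms(1)])
     (simp add: has_bochner_integral_density has_bochner_integral_distr)

section \<open>Complex exponential moments of Gaussian densities\<close>

lemma has_bochner_integral_prod_components:
  fixes f :: "'d::finite \<Rightarrow> real \<Rightarrow> complex"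
  assumes "\<And>i. has_bochner_integral lborel (f i) (I i)"
  shows "has_bochner_integral lborel (\<lambda>x::real ^ 'd. \<Prod>i\<in>UNIV. f i (x $ i)) (\<Prod>i\<in>UNIV. I i)"
proof -
  interpret product_sigma_finite "\<lambda>_::'d. lborel :: real measure" ..
  have i: "integrable lborel (f i)" and I: "integral\<^sup>L lborel (f i) = I i" for i
    using assms by (auto simp: has_bochner_integral_iff)
  have [measurable]: "f i \<in> borel_measurable borel" for i
    using borel_measurable_integrable[OF i] by simp
  have "has_bochner_integral (\<Pi>\<^sub>M i\<in>(UNIV::'d set). (lborel::real measure)) (\<lambda>x. \<Prod>i\<in>UNIV. f i (x i)) (\<Prod>i\<in>UNIV. I i)"
    unfolding has_bochner_integral_iff
    using product_integrable_prod[of UNIV f] product_integral_prod[of UNIV f] i I by simp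
  then show ?thesis
    by (subst lborel_vec_eq) (simp add: has_bochner_integral_distr measurable_vec_lambda_lborel)
qed

text \<open>For real \<open>w\<close> this is the characteristic function of the standard normal
  distribution. Completing the square absorbs the imaginary part of \<open>w\<close> into a real
  translation, so no contour has to be shifted.\<close>

lemma has_bochner_integral_exp_std_normal:
  fixes w :: complex
  shows "has_bochner_integral lborel (\<lambda>y. exp (\<i> * w * of_real y) * of_real (std_normal_density y)) (exp (- w\<^sup>2 / 2))"
proof -
  have real: "has_bochner_integral lborel (\<lambda>y. iexp (u * y) * of_real (std_normal_density y)) (exp (- (of_real u)\<^sup>2 / 2))" for u
  proof -
    have "integrable lborel (\<lambda>y. iexp (u * y) * of_real (std_normal_density y))"
      by (rule Bochner_Integration.integrable_bound[OF integrable_normal_density[of 1 0]]) (auto simp: norm_mult)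
    moreover have "(\<integral>y. iexp (u * y) * of_real (std_normal_density y) \<partial>lborel) = char std_normal_distribution u"
      unfolding char_def by (subst integral_density) (auto simp: scaleR_conv_of_real mult.commute)
    ultimately show ?thesis
      by (simp add: has_bochner_integral_iff char_std_normal_distribution exp_of_real[symmetric])
  qed
  define u v where "u = Re w" and "v = Im w"
  have w: "w = of_real u + \<i> * of_real v" by (simp add: u_def v_def complex_eq_iff)
  \<comment> \<open>With y replaced by v + y, the exponents satisfy - v y - y^2/2 = v^2/2 - (v +
    y)^2/2 and i u y = i u (v + y) - i u v; \<open>?c\<close> collects the terms free of y.\<close>
  let ?c = "exp (of_real (v\<^sup>2 / 2) - \<i> * of_real (u * v)) :: complex"
  have "has_bochner_integral lborel (\<lambda>y. iexp (u * (v + 1 * y)) * of_real (std_normal_density (v + 1 * y))) (exp (- (of_real u)\<^sup>2 / 2))"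
    using real[of u] by (subst (asm) lborel_has_bochner_integral_real_affine_iff[of 1 _ _ v]) auto
  then have "has_bochner_integral lborel (\<lambda>y. ?c * (iexp (u * (v + 1 * y)) * of_real (std_normal_density (v + 1 * y)))) (?c * exp (- (of_real u)\<^sup>2 / 2))"
    by (rule has_bochner_integral_mult_right) 
  moreover have "?c * (iexp (u * (v + 1 * y)) * of_real (std_normal_density (v + 1 * y))) = exp (\<i> * w * of_real y) * of_real (std_normal_density y)" for y
  proof -
    have s: "of_real (std_normal_density x) = of_real (1 / sqrt (2 * pi)) * exp (of_real (- x\<^sup>2 / 2) :: complex)" for x
      unfolding std_normal_density_def of_real_mult exp_of_real[symmetric] by simp
    have "?c * (iexp (u * (v + 1 * y)) * exp (of_real (- (v + 1 * y)\<^sup>2 / 2) :: complex)) = exp (\<i> * w * of_real y) * exp (of_real (- y\<^sup>2 / 2))"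
      unfolding exp_add[symmetric] w by (simp add: algebra_simps power2_eq_square add_divide_distrib diff_divide_distrib)
    then show ?thesis unfolding s by (simp add: mult.left_commute)
  qed
  moreover have "?c * exp (- (of_real u)\<^sup>2 / 2) = exp (- w\<^sup>2 / 2)"
    unfolding exp_add[symmetric] w by (simp add: algebra_simps power2_eq_square add_divide_distrib diff_divide_distrib)
  ultimately show ?thesis by simp
qed

text \<open>\<open>A\<close> comes from a maximal set of vectors orthonormal for \<open>x \<bullet> (D *v y)\<close>, which is a basis.\<close>

lemma positive_definite_factorization:
  fixes D :: "real ^ 'd ^ 'd::finite"
  assumes sym: "transpose D = D" and pos: "\<And>x. x \<noteq> 0 \<Longrightarrow> x \<bullet> (D *v x) > 0"
  obtains A where "det A \<noteq> 0" "A ** transpose A = D"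
proof -
  define orth where "orth S \<longleftrightarrow> finite S \<and> (\<forall>b\<in>S. \<forall>c\<in>S. b \<bullet> (D *v c) = of_bool (b = c))" for S
  have symm: "x \<bullet> (D *v y) = y \<bullet> (D *v x)" for x y
    by (metis dot_lmul_matrix inner_commute sym transpose_matrix_vector)
  have indep: "independent S" if o: "orth S" for S
  proof
    assume "dependent S"
    then obtain u c where c: "c \<in> S" "u c \<noteq> 0" and 0: "(\<Sum>b\<in>S. u b *\<^sub>R b) = 0"
      using o dependent_finite[of S] unfolding orth_def by blast
    have "0 = (\<Sum>b\<in>S. u b *\<^sub>R b) \<bullet> (D *v c)" using 0 by simp
    also have "\<dots> = (\<Sum>b\<in>S. if b = c then u c else 0)"
      unfolding inner_sum_left using that c by (intro sum.cong) (auto simp: orth_def)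
    also have "\<dots> = u c" using that c by (simp add: orth_def)
    finally show False using c by simp
  qed
  have bound: "\<forall>S. orth S \<longrightarrow> card S < Suc (CARD('d))"
  proof (intro allI impI)
    fix S assume "orth S"
    then show "card S < Suc (CARD('d))"
      using independent_bound[OF indep, of S] by simp
  qed
  have e: "orth {}" by (simp add: orth_def)
  obtain S where SS: "orth S \<and> (\<forall>T. orth T \<longrightarrow> card T \<le> card S)"
    using ex_has_greatest_nat[OF e bound] by (elim exE)
  then have S: "orth S" and max: "\<And>T. orth T \<Longrightarrow> card T \<le> card S" by (rule conjunct1) (rule conjunct2[OF SS, rule_format])
  have "card S = CARD('d)"
  proof (rule ccontr)
    assume "card S \<noteq> CARD('d)"
    then have "card S < CARD('d)" using bound[rule_format, OF S] by linarith
    moreover have "dim ((\<lambda>b. D *v b) ` S) \<le> card S"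
      using S dim_le_card'[of "(\<lambda>b. D *v b) ` S"] card_image_le[of S "\<lambda>b. D *v b"] by (simp add: orth_def)
    ultimately have "dim ((\<lambda>b. D *v b) ` S) < DIM(real ^ 'd)" by simp
    then obtain x where x: "x \<noteq> 0" "\<And>y. y \<in> span ((\<lambda>b. D *v b) ` S) \<Longrightarrow> orthogonal x y"
      by (rule orthogonal_to_subspace_exists) blast
    have xS: "x \<bullet> (D *v b) = 0" if "b \<in> S" for b
      using x(2)[of "D *v b"] that by (simp add: orthogonal_def span_base)
    \<comment> \<open>\<open>x\<close> is orthogonal to all D b with b in \<open>S\<close>.
      Normalised with respect to the form of \<open>D\<close>, it would enlarge \<open>S\<close>,
      against maximality.\<close>
    define y where "y = x /\<^sub>R sqrt (x \<bullet> (D *v x))"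
    have yS: "y \<bullet> (D *v b) = 0" if "b \<in> S" for b
      using xS[OF that] by (simp add: y_def)
    have yy: "y \<bullet> (D *v y) = 1"
      using pos[OF x(1)] by (simp add: y_def matrix_vector_mult_scaleR real_sqrt_mult_self field_simps)
    have yn: "y \<notin> S" using yS[of y] yy by auto
    have Sy: "b \<bullet> (D *v y) = 0" if "b \<in> S" for b
      using yS[OF that] by (subst symm)
    have "orth (insert y S)"
      using S yS yy yn Sy by (auto simp: orth_def)
    then have "card (insert y S) \<le> card S" by (rule max)
    then show False using yn S by (simp add: orth_def)
  qed
  then obtain e where e: "bij_betw e (UNIV :: 'd set) S"
    using S finite_same_card_bij[of "UNIV :: 'd set" S] by (auto simp: orth_def)
  \<comment> \<open>The columns of \<open>B\<close> are the orthonormal vectors, so B^T D B = 1.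
    Hence D B is the inverse of B^T, and it can serve as the factor: (D B)(D B)^T = D (B B^T D) =
    D.\<close>
  define B :: "real ^ 'd ^ 'd" where "B = (\<chi> i j. e j $ i)"
  have "(transpose B ** (D ** B)) $ j $ k = e j \<bullet> (D *v e k)" for j k
    by (simp add: B_def matrix_matrix_mult_def transpose_def matrix_vector_mult_def inner_vec_def)
  also have "e j \<bullet> (D *v e k) = (mat 1 :: real ^ 'd ^ 'd) $ j $ k" for j k
    using S e by (auto simp: orth_def mat_def bij_betw_def inj_on_def)
  finally have 1: "transpose B ** (D ** B) = mat 1" by (simp add: vec_eq_iff)
  show thesis
  proof
    have "det (transpose B) * det (D ** B) = 1"
      using 1 by (metis det_I det_mul)
    then show "det (D ** B) \<noteq> 0" by auto
    have "B ** (transpose B ** D) = mat 1"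
      using 1 by (metis matrix_left_right_inverse matrix_mul_assoc)
    then show "(D ** B) ** transpose (D ** B) = D"
      by (metis matrix_mul_assoc matrix_mul_rid matrix_transpose_mul sym)
  qed
qed

text \<open>In the coordinates x = A y the quadratic form becomes the sum of squares, since A^T D^-1
  A = 1, and the Jacobian cancels the square root of det D = (det A)^2.\<close>

lemma gaussian_density_matrix:
  fixes D A :: "real ^ 'd ^ 'd::finite"
  assumes "det A \<noteq> 0" "A ** transpose A = D"
  shows "\<bar>det A\<bar> * gaussian_density D (A *v y) = (\<Prod>i\<in>UNIV. std_normal_density (y $ i))"
proof -
  have dD: "det D = (det A)\<^sup>2"
    by (simp add: assms(2)[symmetric] det_mul power2_eq_square)
  have "invertible D" using assms(1) dD by (simp add: invertible_det_nz)
  then have "D ** matrix_inv D = mat 1"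
    unfolding invertible_def matrix_inv_def by (rule someI2_ex) simp
  then have "A ** (transpose A ** matrix_inv D) = mat 1"
    by (simp add: matrix_mul_assoc assms(2))
  then have 1: "transpose A ** (matrix_inv D ** A) = mat 1"
    by (metis matrix_left_right_inverse matrix_mul_assoc)
  have "(A *v y) \<bullet> (matrix_inv D *v (A *v y)) = y \<bullet> ((transpose A ** (matrix_inv D ** A)) *v y)"
    by (metis dot_lmul_matrix inner_commute matrix_vector_mul_assoc transpose_matrix_vector transpose_transpose)
  also have "\<dots> = (\<Sum>i\<in>UNIV. (y $ i)\<^sup>2)"
    unfolding 1 by (simp add: inner_vec_def power2_eq_square)
  finally have q: "(A *v y) \<bullet> (matrix_inv D *v (A *v y)) = (\<Sum>i\<in>UNIV. (y $ i)\<^sup>2)" .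
  have "\<bar>det A\<bar> * gaussian_density D (A *v y) = 1 / sqrt (2 * pi) ^ CARD('d) * exp (\<Sum>i\<in>UNIV. - (y $ i)\<^sup>2 / 2)"
  proof -
    have "sqrt ((2 * pi) ^ CARD('d) * (det A)\<^sup>2) = sqrt (2 * pi) ^ CARD('d) * \<bar>det A\<bar>"
      unfolding real_sqrt_mult[of "(2 * pi) ^ CARD('d)"] real_sqrt_power[of "2 * pi"] by simp
    then show ?thesis
      using assms(1) unfolding gaussian_density_def q dD
      by (simp add: sum_negf sum_divide_distrib)
  qed
  also have "\<dots> = (\<Prod>i\<in>UNIV. std_normal_density (y $ i))"
    by (simp add: std_normal_density_def exp_sum prod_dividef power_one_over prod.distrib)
  finally show ?thesis .
qed

lemma gaussian_density_pos:
  fixes D :: "real ^ 'd ^ 'd::finite"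
  assumes "positive_definite D"
  shows "gaussian_density D x > 0"
proof -
  obtain A where A: "det A \<noteq> 0" "A ** transpose A = D"
    using assms positive_definite_factorization[of D] unfolding positive_definite_def by blast
  then have "det D > 0"
    by (metis det_mul det_transpose not_real_square_gt_zero)
  then show ?thesis by (simp add: gaussian_density_def)
qed

lemma borel_measurable_gaussian_density [measurable]:
  "gaussian_density D \<in> borel_measurable (borel :: (real ^ 'd::finite) measure)"
  unfolding gaussian_density_def[abs_def] by (simp add: borel_measurable_matrix_vector_mult)

text \<open>After x = A y both the exponential and the density factor over the coordinates, and the
  one-dimensional transform applies to each factor.\<close>

lemma has_bochner_integral_exp_gaussian_density:
  fixes D :: "real ^ 'd ^ 'd::finite"
  assumes "positive_definite D"
  shows "has_bochner_integral lborel
    (\<lambda>x. exp (\<i> * cdot z (\<chi> j. of_real (x $ j))) * of_real (gaussian_density D x))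
    (exp (- (1 / 2) * cdot z (complex_mat D *v z)))"
proof -
  obtain A where A: "det A \<noteq> 0" "A ** transpose A = D"
    using assms positive_definite_factorization[of D] unfolding positive_definite_def by blast
  \<comment> \<open>\<open>w\<close> is A^T z: the exponent becomes i times the bilinear product of
    \<open>w\<close> and y, and the sum of the squares of \<open>w\<close> is z . D z, again without
    conjugation.\<close>
  define w where "w j = (\<Sum>i\<in>UNIV. z $ i * of_real (A $ i $ j))" for j
  have lin: "\<i> * cdot z (\<chi> j. of_real ((A *v y) $ j)) = (\<Sum>j\<in>UNIV. \<i> * w j * of_real (y $ j))" for y :: "real ^ 'd"
  proof -
    have "\<i> * cdot z (\<chi> j. of_real ((A *v y) $ j)) = (\<Sum>i\<in>UNIV. \<Sum>j\<in>UNIV. \<i> * z $ i * of_real (A $ i $ j) * of_real (y $ j))"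
      by (simp add: cdot_def matrix_vector_mult_def sum_distrib_left mult.assoc)
    also have "\<dots> = (\<Sum>j\<in>UNIV. \<Sum>i\<in>UNIV. \<i> * z $ i * of_real (A $ i $ j) * of_real (y $ j))"
      by (rule sum.swap)
    finally show ?thesis by (simp add: w_def sum_distrib_left sum_distrib_right mult.assoc)
  qed
  have quad: "(\<Sum>j\<in>UNIV. (w j)\<^sup>2) = cdot z (complex_mat D *v z)"
  proof -
    have "(\<Sum>j\<in>UNIV. (w j)\<^sup>2) = (\<Sum>j\<in>UNIV. \<Sum>i\<in>UNIV. \<Sum>k\<in>UNIV. z $ i * of_real (A $ i $ j) * (z $ k * of_real (A $ k $ j)))"
      by (simp add: w_def power2_eq_square sum_product)
    also have "\<dots> = (\<Sum>i\<in>UNIV. \<Sum>j\<in>UNIV. \<Sum>k\<in>UNIV. z $ i * of_real (A $ i $ j) * (z $ k * of_real (A $ k $ j)))"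
      by (rule sum.swap)
    also have "\<dots> = (\<Sum>i\<in>UNIV. \<Sum>k\<in>UNIV. \<Sum>j\<in>UNIV. z $ i * of_real (A $ i $ j) * (z $ k * of_real (A $ k $ j)))"
      by (intro sum.cong refl sum.swap)
    also have "\<dots> = (\<Sum>i\<in>UNIV. \<Sum>k\<in>UNIV. z $ i * (of_real ((A ** transpose A) $ i $ k) * z $ k))"
      by (intro sum.cong refl) (simp add: matrix_matrix_mult_def transpose_def sum_distrib_left sum_distrib_right mult_ac)
    also have "\<dots> = cdot z (complex_mat D *v z)"
      by (simp add: A(2) cdot_def complex_mat_def matrix_vector_mult_def sum_distrib_left)
    finally show ?thesis .
  qed
  let ?F = "\<lambda>x. exp (\<i> * cdot z (\<chi> j. of_real (x $ j))) * of_real (gaussian_density D x)"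
  have eq: "\<bar>det A\<bar> *\<^sub>R ?F (A *v y) = (\<Prod>i\<in>UNIV. exp (\<i> * w i * of_real (y $ i)) * of_real (std_normal_density (y $ i)))" for y
  proof -
    have "\<bar>det A\<bar> *\<^sub>R ?F (A *v y) = exp (\<i> * cdot z (\<chi> j. of_real ((A *v y) $ j))) * of_real (\<bar>det A\<bar> * gaussian_density D (A *v y))"
      by (simp add: scaleR_conv_of_real)
    also have "\<dots> = (\<Prod>i\<in>UNIV. exp (\<i> * w i * of_real (y $ i))) * of_real (\<Prod>i\<in>UNIV. std_normal_density (y $ i))"
      unfolding lin gaussian_density_matrix[OF A] by (simp add: exp_sum)
    finally show ?thesis by (simp add: prod.distrib)
  qed
  show ?thesis
  proof (rule has_bochner_integral_lborel_matrix[OF A(1)])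
    have [measurable]: "(\<lambda>x::real ^ 'd. x $ j) \<in> borel_measurable borel" for j
      by (intro borel_measurable_continuous_onI continuous_intros)
    show "?F \<in> borel_measurable borel"
      unfolding cdot_def by simp
    have "(\<Prod>i\<in>UNIV. exp (- (w i)\<^sup>2 / 2)) = exp (- (1 / 2) * cdot z (complex_mat D *v z))"
      unfolding quad[symmetric] by (simp add: exp_sum[symmetric] sum_negf sum_divide_distrib)
    then show "has_bochner_integral lborel (\<lambda>y. \<bar>det A\<bar> *\<^sub>R ?F (A *v y)) (exp (- (1 / 2) * cdot z (complex_mat D *v z)))"
      unfolding eq using has_bochner_integral_prod_components[OF has_bochner_integral_exp_std_normal, of w] by simp
  qed
qed

section \<open>From exponentials to polynomially bounded functions\<close>

text \<open>The factor \<open>c\<close> is not absorbed into \<open>G\<close> in order to allow \<open>c = 0\<close>, which is the case \<open>\<psi>\<^sub>0 = 0\<close>, while \<open>F\<close> still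
  has to be integrable.\<close>

definition converges_to_integral ::
  "real \<Rightarrow> (real \<Rightarrow> 'a \<Rightarrow> real) \<Rightarrow> (real \<Rightarrow> 'a \<Rightarrow> 'b) \<Rightarrow> 'b measure \<Rightarrow> ('b \<Rightarrow> complex) \<Rightarrow> bool" where
  "converges_to_integral c m X G F \<longleftrightarrow>
     (\<forall>\<^sub>F t in at_top. (\<lambda>x. F (X t x) * of_real (m t x)) summable_on UNIV) \<and>
     integrable G F \<and>
     ((\<lambda>t. \<Sum>\<^sub>\<infinity>x. F (X t x) * of_real (m t x)) \<longlongrightarrow> of_real c * (\<integral>x. F x \<partial>G)) at_top"

section \<open>Sums, multiples and weighted limits of convergent observables\<close>

lemma converges_to_integral_add:
  assumes F: "converges_to_integral c m X G F" and H: "converges_to_integral c m X G H"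
  shows "converges_to_integral c m X G (\<lambda>x. F x + H x)"
proof -
  have ev: "\<forall>\<^sub>F t in at_top. (\<lambda>x. F (X t x) * of_real (m t x)) summable_on UNIV \<and> (\<lambda>x. H (X t x) * of_real (m t x)) summable_on UNIV"
    using F H by (auto simp: converges_to_integral_def eventually_conj_iff)
  have "\<forall>\<^sub>F t in at_top. (\<lambda>x. (F (X t x) + H (X t x)) * of_real (m t x)) summable_on UNIV"
    using ev by eventually_elim (simp add: distrib_right summable_on_add)
  moreover have "((\<lambda>t. \<Sum>\<^sub>\<infinity>x. (F (X t x) + H (X t x)) * of_real (m t x)) \<longlongrightarrow> of_real c * (\<integral>x. F x \<partial>G) + of_real c * (\<integral>x. H x \<partial>G)) at_top"
  proof (rule Lim_transform_eventually)
    show "((\<lambda>t. (\<Sum>\<^sub>\<infinity>x. F (X t x) * of_real (m t x)) + (\<Sum>\<^sub>\<infinity>x. H (X t x) * of_real (m t x))) \<longlongrightarrow> of_real c * (\<integral>x. F x \<partial>G) + of_real c * (\<integral>x. H x \<partial>G)) at_top"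
      using F H by (intro tendsto_add) (auto simp: converges_to_integral_def)
    show "\<forall>\<^sub>F t in at_top. (\<Sum>\<^sub>\<infinity>x. F (X t x) * of_real (m t x)) + (\<Sum>\<^sub>\<infinity>x. H (X t x) * of_real (m t x)) = (\<Sum>\<^sub>\<infinity>x. (F (X t x) + H (X t x)) * of_real (m t x))"
      using ev by eventually_elim (simp add: distrib_right infsum_add)
  qed
  ultimately show ?thesis
    using F H by (simp add: converges_to_integral_def distrib_left)
qed

lemma converges_to_integral_cmult:
  assumes "converges_to_integral c m X G F"
  shows "converges_to_integral c m X G (\<lambda>x. b * F x)"
proof -
  have "\<forall>\<^sub>F t in at_top. (\<lambda>x. b * F (X t x) * of_real (m t x)) summable_on UNIV"
  proof (rule eventually_mono)
    show "\<forall>\<^sub>F t in at_top. (\<lambda>x. F (X t x) * of_real (m t x)) summable_on UNIV"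
      using assms by (simp add: converges_to_integral_def)
  qed (simp only: mult.assoc summable_on_cmult_right)
  moreover have "((\<lambda>t. \<Sum>\<^sub>\<infinity>x. b * F (X t x) * of_real (m t x)) \<longlongrightarrow> of_real c * (\<integral>x. b * F x \<partial>G)) at_top"
  proof -
    have "((\<lambda>t. \<Sum>\<^sub>\<infinity>x. F (X t x) * of_real (m t x)) \<longlongrightarrow> of_real c * (\<integral>x. F x \<partial>G)) at_top"
      using assms by (simp add: converges_to_integral_def)
    from tendsto_mult_left[OF this, of b] show ?thesis
      unfolding mult.assoc infsum_cmult_right' by (simp add: mult.left_commute)
  qed
  ultimately show ?thesis
    using assms by (simp add: converges_to_integral_def)
qed

text \<open>A three-epsilon argument with errors measured by \<open>W\<close> instead of the
  supremum norm. Sums and integrals of the error are at most \<open>e\<close> times those of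
  \<open>W\<close>, and the sums of \<open>W\<close> converge and therefore stay bounded for large
  t.\<close>

lemma converges_to_integral_approx:
  assumes c: "c \<ge> 0" and m: "\<And>t x. m t x \<ge> 0"
    and W: "converges_to_integral c m X G (\<lambda>x. of_real (W x))"
    and F: "F \<in> borel_measurable G"
    and approx: "\<And>e. e > 0 \<Longrightarrow> \<exists>H. converges_to_integral c m X G H \<and> (\<forall>x. cmod (F x - H x) \<le> e * W x)"
  shows "converges_to_integral c m X G F"
proof -
  \<comment> \<open>One approximant with error 1 already yields nonnegativity of \<open>W\<close>,
    and by domination the summability and integrability of \<open>F\<close>.\<close>
  obtain H1 where H1: "converges_to_integral c m X G H1" and a1: "\<And>x. cmod (F x - H1 x) \<le> W x"
    using approx[of 1] by auto
  have W0: "W x \<ge> 0" for x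
    using order_trans[OF norm_ge_zero a1] .
  let ?S = "\<lambda>F t. \<Sum>\<^sub>\<infinity>x. F (X t x) * of_real (m t x)"
  let ?s = "\<lambda>F t. (\<lambda>x. F (X t x) * complex_of_real (m t x)) summable_on UNIV"
  have summ: "?s F t" if "?s H1 t" "?s (\<lambda>x. of_real (W x)) t" for t
  proof -
    have "(\<lambda>x. cmod (H1 (X t x) * of_real (m t x)) + cmod (of_real (W (X t x)) * of_real (m t x))) summable_on UNIV"
      using that by (intro summable_on_add) (simp_all add: summable_on_iff_abs_summable_on_complex)
    then have "(\<lambda>x. norm (cmod (H1 (X t x) * of_real (m t x)) + cmod (of_real (W (X t x)) * of_real (m t x)))) summable_on UNIV"
      by simp
    then have "(\<lambda>x. norm (F (X t x) * of_real (m t x))) summable_on UNIV"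
    proof (rule Infinite_Sum.abs_summable_on_comparison_test)
      fix x
      have "cmod (F (X t x)) \<le> cmod (H1 (X t x)) + W (X t x)"
        using a1[of "X t x"] norm_triangle_sub[of "F (X t x)" "H1 (X t x)"] by linarith
      then have "cmod (F (X t x)) * m t x \<le> (cmod (H1 (X t x)) + W (X t x)) * m t x"
        by (intro mult_right_mono m)
      then show "norm (F (X t x) * of_real (m t x)) \<le> norm (cmod (H1 (X t x) * of_real (m t x)) + cmod (of_real (W (X t x)) * of_real (m t x)))"
        using m W0 by (simp add: norm_mult distrib_right abs_mult)
    qed
    then show ?thesis by (simp add: summable_on_iff_abs_summable_on_complex)
  qed
  have sF: "\<forall>\<^sub>F t in at_top. ?s F t"
    using H1 W summ unfolding converges_to_integral_def by (auto elim: eventually_elim2)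
  have iW: "integrable G W"
    using W unfolding converges_to_integral_def by (simp add: complex_of_real_integrable_eq)
  have iF: "integrable G F"
  proof (rule Bochner_Integration.integrable_bound[OF _ F])
    show "integrable G (\<lambda>x. cmod (H1 x) + W x)"
      using H1 iW by (simp add: converges_to_integral_def)
    show "AE x in G. norm (F x) \<le> norm (cmod (H1 x) + W x)"
    proof (rule AE_I2)
      fix x show "norm (F x) \<le> norm (cmod (H1 x) + W x)"
        using a1[of x] norm_triangle_sub[of "F x" "H1 x"] W0[of x] by simp
    qed
  qed
  define w where "w = c * (\<integral>x. W x \<partial>G)"
  have w0: "w \<ge> 0" unfolding w_def using W0 c by simp
  have limW: "((\<lambda>t. cmod (?S (\<lambda>x. of_real (W x)) t)) \<longlongrightarrow> w) at_top"
  proof -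
    have "((\<lambda>t. cmod (?S (\<lambda>x. of_real (W x)) t)) \<longlongrightarrow> cmod (of_real c * (\<integral>x. of_real (W x) \<partial>G))) at_top"
      using W unfolding converges_to_integral_def by (intro tendsto_norm) auto
    moreover have "cmod (of_real c * (\<integral>x. of_real (W x) \<partial>G)) = w"
      using w0 unfolding w_def by (simp flip: of_real_mult)
    ultimately show ?thesis by simp
  qed
  define I where "I F = of_real c * (\<integral>x. F x \<partial>G)" for F :: "'b \<Rightarrow> complex"
  have "(?S F \<longlongrightarrow> I F) at_top"
  proof (rule tendstoI)
    fix e :: real assume e: "e > 0"
    \<comment> \<open>\<open>w\<close> is the limit of the sums of \<open>W\<close>, so these are
      eventually below w + 1. The factor makes the error in the sums at most e/3 and the error in
      the integrals less than e/3; the last third is for the convergence of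
      \<open>H\<close>.\<close>
    define d where "d = e / (3 * (w + 1))"
    have d: "d > 0" using e w0 by (simp add: d_def)
    have "w + 1 \<noteq> 0" using w0 by linarith
    then have dw: "d * (w + 1) = e / 3" unfolding d_def by (metis nonzero_divide_mult_cancel_right mult.commute divide_divide_eq_left nonzero_eq_divide_eq)
    then have dw': "d * w < e / 3" using d by (simp add: algebra_simps)
    obtain H where H: "converges_to_integral c m X G H" and a: "\<And>x. cmod (F x - H x) \<le> d * W x"
      using approx[OF d] by auto
    have iH: "integrable G H" using H by (simp add: converges_to_integral_def)
    have "cmod (\<integral>x. F x - H x \<partial>G) \<le> (\<integral>x. cmod (F x - H x) \<partial>G)"
      by (rule integral_norm_bound)
    also have "\<dots> \<le> (\<integral>x. d * W x \<partial>G)"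
      using iF iH iW a by (intro integral_mono) auto
    finally have "c * cmod (\<integral>x. F x - H x \<partial>G) \<le> c * (\<integral>x. d * W x \<partial>G)"
      using c by (rule mult_left_mono)
    moreover have "I F - I H = of_real c * (\<integral>x. F x - H x \<partial>G)"
      using iF iH by (simp add: I_def right_diff_distrib)
    ultimately have "cmod (I F - I H) \<le> d * w"
      using c by (simp add: w_def norm_mult mult.left_commute)
    then have FH: "cmod (I F - I H) < e / 3" using dw' by simp
    have sH: "\<forall>\<^sub>F t in at_top. ?s H t" and sW: "\<forall>\<^sub>F t in at_top. ?s (\<lambda>x. of_real (W x)) t"
      and tH: "\<forall>\<^sub>F t in at_top. dist (?S H t) (I H) < e / 3"
      using H W e by (auto simp: converges_to_integral_def I_def dest: tendstoD[where e = "e / 3"])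
    have tW: "\<forall>\<^sub>F t in at_top. cmod (?S (\<lambda>x. of_real (W x)) t) < w + 1"
      using limW by (rule order_tendstoD) simp
    show "\<forall>\<^sub>F t in at_top. dist (?S F t) (I F) < e"
      using sF sH sW tH tW
    proof eventually_elim
      case (elim t)
      have dif: "(\<lambda>x. (F (X t x) - H (X t x)) * of_real (m t x)) summable_on UNIV"
        using summable_on_add[OF elim(1) summable_on_cmult_right[OF elim(2), of "-1"]] by (simp add: algebra_simps)
      have nH: "(\<lambda>x. - (H (X t x) * of_real (m t x))) summable_on UNIV"
        using summable_on_cmult_right[OF elim(2), of "-1"] by simp
      have "?S F t - ?S H t = ?S F t + (\<Sum>\<^sub>\<infinity>x. (- 1) * (H (X t x) * of_real (m t x)))"
        by (simp only: infsum_cmult_right') simp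
      also have "\<dots> = (\<Sum>\<^sub>\<infinity>x. (F (X t x) - H (X t x)) * of_real (m t x))"
        using elim(1) nH by (subst infsum_add[symmetric]) (auto simp: algebra_simps)
      finally have "cmod (?S F t - ?S H t) = cmod (\<Sum>\<^sub>\<infinity>x. (F (X t x) - H (X t x)) * of_real (m t x))" by simp
      also have "\<dots> \<le> (\<Sum>\<^sub>\<infinity>x. cmod ((F (X t x) - H (X t x)) * of_real (m t x)))"
        using dif by (intro norm_infsum_bound) (simp add: summable_on_iff_abs_summable_on_complex)
      also have "\<dots> \<le> (\<Sum>\<^sub>\<infinity>x. d * cmod (of_real (W (X t x)) * of_real (m t x)))"
      proof (rule infsum_mono)
        show "(\<lambda>x. cmod ((F (X t x) - H (X t x)) * of_real (m t x))) summable_on UNIV"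
          using dif by (simp add: summable_on_iff_abs_summable_on_complex)
        show "(\<lambda>x. d * cmod (of_real (W (X t x)) * of_real (m t x))) summable_on UNIV"
          using elim(3) by (intro summable_on_cmult_right) (simp add: summable_on_iff_abs_summable_on_complex)
        fix x
        show "cmod ((F (X t x) - H (X t x)) * of_real (m t x)) \<le> d * cmod (of_real (W (X t x)) * of_real (m t x))"
          using mult_right_mono[OF a m[of t x], of "X t x"] m[of t x] W0[of "X t x"] by (simp add: norm_mult mult.assoc)
      qed
      also have "\<dots> = d * (\<Sum>\<^sub>\<infinity>x. cmod (of_real (W (X t x)) * of_real (m t x)))"
        by (rule infsum_cmult_right')
      also have "(\<Sum>\<^sub>\<infinity>x. cmod (of_real (W (X t x)) * of_real (m t x))) = (\<Sum>\<^sub>\<infinity>x. Re (of_real (W (X t x)) * of_real (m t x)))"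
        using m W0 by (simp add: norm_mult)
      also have "\<dots> = Re (?S (\<lambda>x. of_real (W x)) t)"
        by (rule infsum_Re[OF elim(3)])
      also have "d * Re (?S (\<lambda>x. of_real (W x)) t) \<le> d * (w + 1)"
        using d elim(5) complex_Re_le_cmod[of "?S (\<lambda>x. of_real (W x)) t"] by (intro mult_left_mono) auto
      finally have "cmod (?S F t - ?S H t) \<le> e / 3" by (simp add: dw)
      moreover have "cmod (?S F t - I F) \<le> cmod (?S F t - ?S H t) + cmod (?S H t - I H) + cmod (I F - I H)"
        using norm_triangle_ineq[of "?S F t - ?S H t" "?S H t - I H"]
          norm_triangle_ineq4[of "?S F t - I H" "I F - I H"] by simp
      ultimately show ?case using FH elim(4) by (simp add: dist_norm)
    qed
  qed
  then show ?thesis using sF iF by (simp add: converges_to_integral_def I_def)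
qed

section \<open>Finite sums of exponentials with complex frequencies\<close>

inductive exp_sum :: "(real ^ 'd::finite \<Rightarrow> complex) \<Rightarrow> bool" where
  exp: "exp_sum (\<lambda>x. c * exp (\<i> * cdot z (\<chi> j. of_real (x $ j))))"
| add: "exp_sum F \<Longrightarrow> exp_sum H \<Longrightarrow> exp_sum (\<lambda>x. F x + H x)"

lemma exp_sum_const: "exp_sum (\<lambda>x. c)"
  using exp_sum.exp[of c 0] by (simp add: cdot_def)

text \<open>The frequency - i a in direction \<open>j\<close> gives exp (a x_j). Real
  \<open>a\<close> produces the terms of the weight, imaginary \<open>a\<close> the terms of a
  sine.\<close>

lemma exp_sum_exp_component:
  fixes j :: "'d::finite"
  shows "exp_sum (\<lambda>x::real ^ 'd. c * exp (a * of_real (x $ j)))"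
proof -
  have "(\<i> * cdot (axis j (- \<i> * a)) (\<chi> j. of_real (x $ j))) = a * of_real (x $ j)" for x :: "real ^ 'd"
    by (simp add: cdot_def axis_def if_distrib if_distribR mult.assoc[symmetric] cong: if_cong)
  then show ?thesis
    using exp_sum.exp[of c "axis j (- \<i> * a)"] by (simp only:)
qed

text \<open>Frequencies add under multiplication, so the exponential sums form an algebra and
  contain the polynomials in their elements.\<close>

lemma exp_sum_mult:
  fixes F H :: "real ^ 'd::finite \<Rightarrow> complex"
  assumes "exp_sum F" "exp_sum H"
  shows "exp_sum (\<lambda>x. F x * H x)"
  using assms(1)
proof induction
  case (exp c z)
  show ?case using assms(2)
  proof induction
    case (exp c' z')
    have "c * exp (\<i> * cdot z (\<chi> j. of_real (x $ j))) * (c' * exp (\<i> * cdot z' (\<chi> j. of_real (x $ j)))) 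
      = (c * c') * exp (\<i> * cdot (z + z') (\<chi> j. of_real (x $ j)))" for x :: "real ^ 'd"
      by (simp add: cdot_def algebra_simps sum.distrib exp_add)
    then show ?case using exp_sum.exp[of "c * c'" "z + z'"] by (simp only:)
  next
    case (add F H)
    then show ?case using exp_sum.add by (simp add: distrib_left)
  qed
next
  case (add F H)
  then show ?case using exp_sum.add by (simp add: distrib_right)
qed

lemma exp_sum_sum:
  assumes "\<And>i. i \<in> I \<Longrightarrow> exp_sum (F i)"
  shows "exp_sum (\<lambda>x. \<Sum>i\<in>I. F i x)"
  using assms
  by (induction I rule: infinite_finite_induct) (auto simp: exp_sum_const intro: exp_sum.add)

text \<open>By Euler's formula a linear form in the sines is a combination of exponentials with
  frequencies 1/L and -1/L; the other polynomial functions arise from these and constants by sums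
  and products.\<close>

lemma exp_sum_polynomial_sin:
  assumes "real_polynomial_function (p :: real ^ 'd::finite \<Rightarrow> real)"
  shows "exp_sum (\<lambda>x. of_real (p (\<chi> j. sin (x $ j / L))))"
  using assms
proof induction
  case (linear f)
  have sin_exp: "complex_of_real (sin (t / L)) = 1 / (2 * \<i>) * exp (\<i> / of_real L * of_real t) + (- 1 / (2 * \<i>)) * exp (- \<i> / of_real L * of_real t)" for t
    by (simp add: sin_of_real[symmetric] sin_exp_eq algebra_simps diff_divide_distrib)
  have "linear f" by (rule bounded_linear.linear[OF linear])
  then have f: "f y = (\<Sum>j\<in>UNIV. f (axis j 1) * y $ j)" for y
  proof -
    have "f y = f (\<Sum>j\<in>UNIV. y $ j *\<^sub>R axis j 1)"
      by (subst basis_expansion[of y, symmetric]) (simp add: scalar_mult_eq_scaleR)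
    then show ?thesis
      using \<open>linear f\<close> by (simp add: linear_sum linear_cmul mult.commute)
  qed
  have "of_real (f (\<chi> j. sin (x $ j / L))) =
    (\<Sum>j\<in>UNIV. of_real (f (axis j 1)) * (1 / (2 * \<i>) * exp (\<i> / of_real L * of_real (x $ j)) + (- 1 / (2 * \<i>)) * exp (- \<i> / of_real L * of_real (x $ j))))" for x :: "real ^ 'd"
    by (subst f) (simp only: of_real_sum of_real_mult vec_lambda_beta sin_exp)
  moreover have "exp_sum \<dots>"
    by (intro exp_sum_sum exp_sum_mult exp_sum_const exp_sum.add exp_sum_exp_component)
  ultimately show ?case by simp
qed (auto intro: exp_sum_const exp_sum.add exp_sum_mult)

lemma converges_to_integral_exp_sum:
  assumes "exp_sum F"
    and "\<And>z. converges_to_integral c m X G (\<lambda>x. exp (\<i> * cdot z (\<chi> j. of_real (x $ j))))"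
  shows "converges_to_integral c m X G F"
  using assms(1)
  by induction (auto intro: converges_to_integral_add converges_to_integral_cmult assms(2))

section \<open>Growth bounds and trigonometric approximation\<close>

lemma power_le_fact_exp:
  fixes u :: real
  assumes "u \<ge> 0"
  shows "u ^ n \<le> fact n * exp u"
proof -
  have "(\<Sum>i\<in>{n}. u ^ i /\<^sub>R fact i) \<le> (\<Sum>i. u ^ i /\<^sub>R fact i)"
    using assms summable_exp_generic[of u] by (intro sum_le_suminf) auto
  then have "u ^ n / fact n \<le> exp u" by (simp add: exp_def divide_inverse mult.commute)
  then show ?thesis by (simp add: field_simps)
qed

lemma abs_arcsin_sin_le: "\<bar>arcsin (sin t)\<bar> \<le> \<bar>t\<bar>" for t :: real
proof (cases "\<bar>t\<bar> \<le> pi / 2")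
  case True
  then show ?thesis by (simp add: arcsin_sin abs_le_iff)
next
  case False
  then show ?thesis using arcsin_bounded[of "sin t"] by (simp add: abs_le_iff)
qed

text \<open>The right-hand side is an exponential sum, which a power of the norm is not. If M is the
  largest |x_j|, then 1 + |x| is at most d (1 + M), the power of 1 + M is at most n! exp (1 + M),
  and exp M is one of the exponentials because both signs occur.\<close>

lemma one_plus_norm_power_le:
  fixes x :: "real ^ 'd::finite"
  shows "(1 + norm x) ^ n \<le> real CARD('d) ^ n * fact n * exp 1 * (\<Sum>j\<in>UNIV. exp (x $ j) + exp (- (x $ j)))"
proof -
  let ?d = "real CARD('d)"
  define M where "M = Max (range (\<lambda>j. \<bar>x $ j\<bar>))"
  have "M \<in> range (\<lambda>j. \<bar>x $ j\<bar>)" unfolding M_def by (rule Max_in) auto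
  then obtain j where j: "M = \<bar>x $ j\<bar>" by auto
  have M: "\<bar>x $ k\<bar> \<le> M" for k unfolding M_def by (rule Max_ge) auto
  have d: "?d \<ge> 1" using zero_less_card_finite[where 'a='d] by simp
  have "norm x \<le> (\<Sum>k\<in>UNIV. \<bar>x $ k\<bar>)" by (rule norm_le_l1_cart)
  also have "\<dots> \<le> (\<Sum>k\<in>(UNIV::'d set). M)" using M by (intro sum_mono) auto
  also have "\<dots> = ?d * M" by simp
  finally have "1 + norm x \<le> ?d * (1 + M)" unfolding distrib_left using d by linarith
  then have "(1 + norm x) ^ n \<le> (?d * (1 + M)) ^ n" by (intro power_mono) auto
  also have "\<dots> = ?d ^ n * (1 + M) ^ n" by (rule power_mult_distrib)
  also have "\<dots> \<le> ?d ^ n * (fact n * exp (1 + M))"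
    using j by (intro mult_left_mono power_le_fact_exp) auto
  also have "\<dots> = ?d ^ n * fact n * exp 1 * exp M" by (simp add: exp_add)
  also have "\<dots> \<le> ?d ^ n * fact n * exp 1 * (\<Sum>j\<in>UNIV. exp (x $ j) + exp (- (x $ j)))"
  proof (rule mult_left_mono)
    have "exp M \<le> exp (x $ j) + exp (- (x $ j))"
      unfolding j by (cases "x $ j \<ge> 0") (auto simp: abs_if)
    also have "\<dots> \<le> (\<Sum>j\<in>UNIV. exp (x $ j) + exp (- (x $ j)))"
      by (rule member_le_sum[of j UNIV "\<lambda>j. exp (x $ j) + exp (- (x $ j))"]) (auto intro: add_nonneg_nonneg)
    finally show "exp M \<le> (\<Sum>j\<in>UNIV. exp (x $ j) + exp (- (x $ j)))" .
  qed simp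
  finally show ?thesis .
qed

text \<open>Approximating \<open>f (L * arcsin y)\<close> on the cube and substituting \<open>y = sin (x / L)\<close> makes the error small
  near the origin and keeps it bounded by the growth of \<open>f\<close> elsewhere, since \<open>\<bar>arcsin (sin t)\<bar> \<le> \<bar>t\<bar>\<close>.\<close>

lemma trigonometric_approximation:
  fixes f :: "real ^ 'd::finite \<Rightarrow> real"
  assumes cont: "continuous_on UNIV f" and bound: "\<And>x. \<bar>f x\<bar> \<le> C * (1 + norm x) ^ n" and C: "C \<ge> 0"
    and L: "L \<ge> 1"
  obtains p where "real_polynomial_function p"
    "\<And>x. \<bar>f x - p (\<chi> j. sin (x $ j / L))\<bar> \<le> (1 + 2 * C) / L * (1 + norm x) ^ Suc n"
proof -
  let ?B = "cbox (\<chi> j. -1) (\<chi> j. 1) :: (real ^ 'd) set"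
  have gc: "continuous_on ?B (\<lambda>y. f (\<chi> j. L * arcsin (y $ j)))"
  proof (rule continuous_on_compose2[OF cont])
    show "continuous_on ?B (\<lambda>y. \<chi> j. L * arcsin (y $ j))"
      by (intro continuous_intros) (auto simp: mem_box_cart)
  qed simp
  have L': "0 < 1 / L" using L by simp
  obtain p where p: "real_polynomial_function p"
    and ap: "\<And>y. y \<in> ?B \<Longrightarrow> \<bar>f (\<chi> j. L * arcsin (y $ j)) - p y\<bar> < 1 / L"
    by (rule Stone_Weierstrass_real_polynomial_function[OF compact_cbox gc L']) blast
  show thesis
  proof (rule that[OF p])
    fix x :: "real ^ 'd"
    let ?s = "\<chi> j. sin (x $ j / L)"
    define a :: "real ^ 'd" where "a = (\<chi> j. L * arcsin (sin (x $ j / L)))"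
    have 1: "\<bar>f a - p ?s\<bar> < 1 / L"
      using ap[of ?s] by (simp add: mem_box_cart a_def)
    have comp: "\<bar>a $ j\<bar> \<le> \<bar>x $ j\<bar>" for j
      using mult_left_mono[OF abs_arcsin_sin_le[of "x $ j / L"], of L] L by (simp add: a_def abs_mult)
    have na: "norm a \<le> norm x"
      unfolding norm_vec_def by (rule L2_set_mono) (use comp in auto)
    have one: "1 \<le> (1 + norm x) ^ k" for k by (rule one_le_power) simp
    \<comment> \<open>On the cube |x_j| \<le> L the arguments x_j / L lie within pi/2, so
      \<open>a\<close> equals \<open>x\<close> and there is no error. Off the cube |x| \<ge> L, and
      one more power of 1 + |x| pays for the factor 1/L; this is the origin of \<open>Suc n\<close>
      and of the summand 2 C.\<close>
    have 2: "\<bar>f x - f a\<bar> \<le> 2 * C / L * (1 + norm x) ^ Suc n"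
    proof (cases "\<forall>j. \<bar>x $ j\<bar> \<le> L")
      case True
      have "a = x"
      proof -
        have "arcsin (sin (x $ j / L)) = x $ j / L" for j
        proof -
          have "\<bar>x $ j / L\<bar> \<le> 1" using True L by simp
          then have "- (pi / 2) \<le> x $ j / L" "x $ j / L \<le> pi / 2"
            using pi_gt3 by linarith+
          then show ?thesis by (rule arcsin_sin)
        qed
        then show ?thesis using L by (simp add: a_def vec_eq_iff)
      qed
      then show ?thesis using C L by simp
    next
      case False
      then obtain j where "L < \<bar>x $ j\<bar>" by (auto simp: not_le)
      then have Lx: "L \<le> norm x" using component_le_norm_cart[of x j] by simp
      have "\<bar>f x - f a\<bar> \<le> \<bar>f x\<bar> + \<bar>f a\<bar>" by simp
      also have "\<dots> \<le> C * (1 + norm x) ^ n + C * (1 + norm a) ^ n"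
        by (intro add_mono bound)
      also have "\<dots> \<le> C * (1 + norm x) ^ n + C * (1 + norm x) ^ n"
        using na C by (intro add_mono mult_left_mono power_mono) auto
      also have "\<dots> = 2 * C / L * (L * (1 + norm x) ^ n)" using L by simp
      also have "\<dots> \<le> 2 * C / L * ((1 + norm x) * (1 + norm x) ^ n)"
        using Lx C L by (intro mult_left_mono mult_right_mono) auto
      finally show ?thesis by simp
    qed
    have "\<bar>f x - p ?s\<bar> \<le> 1 / L * 1 + 2 * C / L * (1 + norm x) ^ Suc n"
      using 1 2 by linarith
    also have "\<dots> \<le> 1 / L * (1 + norm x) ^ Suc n + 2 * C / L * (1 + norm x) ^ Suc n"
      using L by (intro add_mono mult_left_mono one order_refl) auto
    also have "\<dots> = (1 + 2 * C) / L * (1 + norm x) ^ Suc n"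
      by (simp add: add_divide_distrib distrib_right)
    finally show "\<bar>f x - p ?s\<bar> \<le> (1 + 2 * C) / L * (1 + norm x) ^ Suc n" .
  qed
qed

lemma converges_to_integral_polynomially_bounded:
  fixes f :: "real ^ 'd::finite \<Rightarrow> real"
  assumes c: "c \<ge> 0" and m: "\<And>t x. m t x \<ge> 0" and G: "sets G = sets borel"
    and exp: "\<And>z. converges_to_integral c m X G (\<lambda>x. exp (\<i> * cdot z (\<chi> j. of_real (x $ j))))"
    and cont: "continuous_on UNIV f" and pb: "polynomially_bounded f"
  shows "converges_to_integral c m X G (\<lambda>x. of_real (f x))"
proof -
  obtain C n where b: "\<And>x. \<bar>f x\<bar> \<le> C * (1 + norm x) ^ n"
    using pb unfolding polynomially_bounded_def by blast
  have C: "C \<ge> 0" using b[of 0] by simp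
  \<comment> \<open>\<open>K\<close> is the constant of \<open>one_plus_norm_power_le\<close> for
    the exponent \<open>Suc n\<close>. With 1 + 2 C included in \<open>W\<close>, the trigonometric
    error is at most W / L.\<close>
  define K where "K = real CARD('d) ^ Suc n * fact (Suc n) * exp 1"
  define W where "W x = (1 + 2 * C) * K * (\<Sum>j\<in>UNIV. exp (x $ j) + exp (- (x $ j)))" for x :: "real ^ 'd"
  have K: "K \<ge> 0" by (simp add: K_def)
  have W: "(1 + 2 * C) * (1 + norm x) ^ Suc n \<le> W x" for x
    unfolding W_def K_def mult.assoc[of "1 + 2 * C"]
    using C by (intro mult_left_mono one_plus_norm_power_le) auto
  \<comment> \<open>The factors 1 and - 1 put every term in the shape
    \<open>c * exp (a * of_real (x $ j))\<close> of \<open>exp_sum_exp_component\<close>.\<close>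
  have Wexp: "complex_of_real (W x) = of_real ((1 + 2 * C) * K) * (\<Sum>j\<in>UNIV. 1 * exp (1 * of_real (x $ j)) + 1 * exp ((- 1) * of_real (x $ j)))" for x
    by (simp add: W_def exp_of_real[symmetric])
  show ?thesis
  proof (rule converges_to_integral_approx[OF c m])
    show "converges_to_integral c m X G (\<lambda>x. of_real (W x))"
      unfolding Wexp
      by (rule converges_to_integral_exp_sum[OF _ exp])
        (rule exp_sum_mult[OF exp_sum_const exp_sum_sum[OF exp_sum.add[OF exp_sum_exp_component exp_sum_exp_component]]])
    show "(\<lambda>x. complex_of_real (f x)) \<in> borel_measurable G"
      using cont G by (simp add: measurable_cong_sets[OF G refl] borel_measurable_continuous_onI)
    fix e :: real assume e: "e > 0"
    define L where "L = max 1 (1 / e)"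
    have L: "L \<ge> 1" "1 / L \<le> e" using e by (auto simp: L_def field_simps max_def)
    obtain p where p: "real_polynomial_function p"
      and ap: "\<And>x. \<bar>f x - p (\<chi> j. sin (x $ j / L))\<bar> \<le> (1 + 2 * C) / L * (1 + norm x) ^ Suc n"
      using trigonometric_approximation[OF cont b C L(1)] by blast
    have "cmod (of_real (f x) - of_real (p (\<chi> j. sin (x $ j / L)))) \<le> e * W x" for x
    proof -
      have "cmod (of_real (f x) - of_real (p (\<chi> j. sin (x $ j / L)))) = \<bar>f x - p (\<chi> j. sin (x $ j / L))\<bar>"
        by (simp only: of_real_diff[symmetric] norm_of_real)
      also have "\<dots> \<le> (1 / L) * ((1 + 2 * C) * (1 + norm x) ^ Suc n)" using ap[of x] by simp
      also have "\<dots> \<le> e * W x"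
        using L W[of x] e C by (intro mult_mono) auto
      finally show ?thesis .
    qed
    moreover have "converges_to_integral c m X G (\<lambda>x. of_real (p (\<chi> j. sin (x $ j / L))))"
      by (rule converges_to_integral_exp_sum[OF exp_sum_polynomial_sin[OF p] exp])
    ultimately show "\<exists>H. converges_to_integral c m X G H \<and> (\<forall>x. cmod (of_real (f x) - H x) \<le> e * W x)"
      by (intro exI[of _ "\<lambda>x. of_real (p (\<chi> j. sin (x $ j / L)))"]) auto
  qed
qed

section \<open>Uniqueness for the Schroedinger equation\<close>

lemma integrable_product_lborel:
  fixes f g :: "real \<Rightarrow> complex"
  assumes "integrable lborel f" "integrable lborel g"
  shows "integrable (lborel \<Otimes>\<^sub>M lborel) (\<lambda>(x, y). f x * g y)"
proof (rule lborel_pair.Fubini_integrable)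
  have [measurable]: "f \<in> borel_measurable borel" "g \<in> borel_measurable borel"
    using assms[THEN borel_measurable_integrable] by auto
  show "(\<lambda>(x, y). f x * g y) \<in> borel_measurable (lborel \<Otimes>\<^sub>M lborel)" by measurable
  show "integrable lborel (\<lambda>x. \<integral>y. norm (case (x, y) of (x, y) \<Rightarrow> f x * g y) \<partial>lborel)"
    using assms by (simp add: norm_mult)
  show "AE x in lborel. integrable lborel (\<lambda>y. case (x, y) of (x, y) \<Rightarrow> f x * g y)"
    using assms by simp
qed

text \<open>The product rule for |F|^2 when \<open>g\<close> is merely integrable, so that F need
  not be differentiable everywhere. |F(T)|^2 is a double integral over a square; the diagonal cuts
  it into two triangles whose contributions are complex conjugates.\<close>

lemma norm_indefinite_integral_squared:
  fixes g :: "real \<Rightarrow> complex"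
  assumes T: "T \<ge> 0" and g: "set_integrable lborel {0..T} g"
  defines "F \<equiv> \<lambda>t. LINT s:{0..t}|lborel. g s"
  shows "set_integrable lborel {0..T} (\<lambda>s. cnj (F s) * g s)"
    and "(cmod (F T))\<^sup>2 = (LINT s:{0..T}|lborel. 2 * Re (cnj (F s) * g s))"
proof -
  define G where "G s = indicator {0..T} s *\<^sub>R g s" for s
  have iG: "integrable lborel G"
    using g by (simp add: set_integrable_def G_def[abs_def])
  have Gm [measurable]: "G \<in> borel_measurable borel"
    using borel_measurable_integrable[OF iG] by simp
  have [measurable]: "cnj \<in> borel_measurable borel"
    by (intro borel_measurable_continuous_onI continuous_intros)
  have iQ: "integrable (lborel \<Otimes>\<^sub>M lborel) (\<lambda>(s, r). G s * cnj (G r))"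
    using integrable_product_lborel[OF iG, of "\<lambda>r. cnj (G r)"] iG by simp
  define \<Phi> where "\<Phi> s = (\<integral>r. indicator {..s} r *\<^sub>R G r \<partial>lborel)" for s
  have \<Phi>F: "\<Phi> s = F s" if "s \<in> {0..T}" for s
    using that unfolding \<Phi>_def F_def set_lebesgue_integral_def G_def
    by (intro Bochner_Integration.integral_cong) (auto simp: indicator_def)
  have "(\<lambda>(s, r). if r \<le> s then G s * cnj (G r) else 0) \<in> borel_measurable (lborel \<Otimes>\<^sub>M lborel)"
    by measurable
  then have iQ1: "integrable (lborel \<Otimes>\<^sub>M lborel) (\<lambda>(s, r). if r \<le> s then G s * cnj (G r) else 0)"
    by (rule Bochner_Integration.integrable_bound[OF iQ _ AE_I2]) (auto simp: split_beta)
  have "(\<lambda>(s, r). if s < r then G s * cnj (G r) else 0) \<in> borel_measurable (lborel \<Otimes>\<^sub>M lborel)"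
    by measurable
  then have iQ2: "integrable (lborel \<Otimes>\<^sub>M lborel) (\<lambda>(s, r). if s < r then G s * cnj (G r) else 0)"
    by (rule Bochner_Integration.integrable_bound[OF iQ _ AE_I2]) (auto simp: split_beta)
  have inner1: "(\<integral>r. (if r \<le> s then G s * cnj (G r) else 0) \<partial>lborel) = G s * cnj (\<Phi> s)" for s
  proof -
    have "(\<integral>r. (if r \<le> s then G s * cnj (G r) else 0) \<partial>lborel) = (\<integral>r. G s * cnj (indicator {..s} r *\<^sub>R G r) \<partial>lborel)"
      by (intro Bochner_Integration.integral_cong) (auto simp: indicator_def)
    also have "\<dots> = G s * cnj (\<Phi> s)"
      unfolding \<Phi>_def by (simp only: integral_mult_right_zero Bochner_Integration.integral_cnj)
    finally show ?thesis .
  qed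
  have inner2: "(\<integral>s. (if s < r then G s * cnj (G r) else 0) \<partial>lborel) = \<Phi> r * cnj (G r)" for r
  proof -
    \<comment> \<open>The triangle is open at the diagonal while \<open>\<Phi>\<close> integrates up
      to and including r; the two integrands differ at most at the single point s = r.\<close>
    have "(\<integral>s. (if s < r then G s * cnj (G r) else 0) \<partial>lborel) = (\<integral>s. (indicator {..r} s *\<^sub>R G s) * cnj (G r) \<partial>lborel)"
      by (rule integral_cong_AE)
        (auto intro!: eventually_mono[OF AE_lborel_singleton[of r]] simp: indicator_def)
    also have "\<dots> = \<Phi> r * cnj (G r)"
      unfolding \<Phi>_def by (rule integral_mult_left_zero)
    finally show ?thesis .
  qed
  have i1: "integrable lborel (\<lambda>s. G s * cnj (\<Phi> s))"
    using lborel_pair.integrable_fst[OF iQ1] by (simp only: inner1)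
  have eq: "indicator {0..T} s *\<^sub>R (cnj (F s) * g s) = G s * cnj (\<Phi> s)" for s
    using \<Phi>F[of s] by (auto simp: G_def indicator_def)
  show "set_integrable lborel {0..T} (\<lambda>s. cnj (F s) * g s)"
    using i1 unfolding set_integrable_def eq .
  have FT: "F T = (\<integral>s. G s \<partial>lborel)"
    by (simp add: F_def set_lebesgue_integral_def G_def)
  have "of_real ((cmod (F T))\<^sup>2) = (\<integral>s. G s \<partial>lborel) * cnj (\<integral>r. G r \<partial>lborel)"
    unfolding FT by (rule complex_norm_square)
  also have "\<dots> = (\<integral>s. \<integral>r. G s * cnj (G r) \<partial>lborel \<partial>lborel)"
    by simp
  also have "\<dots> = (\<integral>p. (case p of (s, r) \<Rightarrow> G s * cnj (G r)) \<partial>(lborel \<Otimes>\<^sub>M lborel))"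
    by (rule lborel_pair.integral_fst[OF iQ])
  also have "\<dots> = (\<integral>p. (case p of (s, r) \<Rightarrow> (if r \<le> s then G s * cnj (G r) else 0)) + (case p of (s, r) \<Rightarrow> (if s < r then G s * cnj (G r) else 0)) \<partial>(lborel \<Otimes>\<^sub>M lborel))"
    by (intro Bochner_Integration.integral_cong) (auto simp: indicator_def)
  also have "\<dots> = (\<integral>s. \<integral>r. (if r \<le> s then G s * cnj (G r) else 0) \<partial>lborel \<partial>lborel) + (\<integral>r. \<integral>s. (if s < r then G s * cnj (G r) else 0) \<partial>lborel \<partial>lborel)"
    unfolding lborel_pair.integral_fst[OF iQ1] lborel_pair.integral_snd[OF iQ2]
    by (rule Bochner_Integration.integral_add[OF iQ1 iQ2])
  also have "\<dots> = (\<integral>s. G s * cnj (\<Phi> s) \<partial>lborel) + cnj (\<integral>s. G s * cnj (\<Phi> s) \<partial>lborel)"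
    unfolding inner1 inner2 Bochner_Integration.integral_cnj[symmetric] by (simp add: mult.commute)
  also have "\<dots> = of_real (2 * Re (\<integral>s. G s * cnj (\<Phi> s) \<partial>lborel))"
    by (rule complex_add_cnj)
  finally have "(cmod (F T))\<^sup>2 = 2 * Re (\<integral>s. G s * cnj (\<Phi> s) \<partial>lborel)"
    by (simp only: of_real_eq_iff)
  also have "\<dots> = (\<integral>s. 2 * Re (G s * cnj (\<Phi> s)) \<partial>lborel)"
    by (simp only: integral_mult_right_zero integral_Re[OF i1])
  also have "\<dots> = (LINT s:{0..T}|lborel. 2 * Re (cnj (F s) * g s))"
    unfolding set_lebesgue_integral_def eq[symmetric]
    by (intro Bochner_Integration.integral_cong) (auto simp: indicator_def)
  finally show "(cmod (F T))\<^sup>2 = (LINT s:{0..T}|lborel. 2 * Re (cnj (F s) * g s))" .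
qed

section \<open>Bounds for the hopping operator and for the norm on bounded time intervals\<close>

lemma hopping_kernel_summable:
  fixes h :: "int ^ 'd::finite \<Rightarrow> complex"
  assumes "hopping_kernel h"
  shows "(\<lambda>y. cmod (h y)) summable_on UNIV"
proof -
  obtain m where m: "m > 0" and s: "(\<lambda>y. exp (m * l1_norm y) * cmod (h y)) summable_on UNIV"
    using assms unfolding hopping_kernel_def by blast
  show ?thesis
  proof (rule summable_on_comparison_test[OF s])
    fix y :: "int ^ 'd"
    have "l1_norm y \<ge> 0" by (simp add: l1_norm_def sum_nonneg)
    then have "1 \<le> exp (m * l1_norm y)" using m by simp
    then show "cmod (h y) \<le> exp (m * l1_norm y) * cmod (h y)"
      using mult_right_mono[of 1 _ "cmod (h y)"] by simp
  qed simp
qed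

lemma infsum_finite_sum:
  fixes f :: "'a \<Rightarrow> 'b \<Rightarrow> real"
  assumes "finite S" "\<And>x. x \<in> S \<Longrightarrow> f x summable_on A"
  shows "(\<lambda>y. \<Sum>x\<in>S. f x y) summable_on A" and "(\<Sum>\<^sub>\<infinity>y\<in>A. \<Sum>x\<in>S. f x y) = (\<Sum>x\<in>S. \<Sum>\<^sub>\<infinity>y\<in>A. f x y)"
proof -
  have "(\<lambda>y. \<Sum>x\<in>S. f x y) summable_on A \<and> (\<Sum>\<^sub>\<infinity>y\<in>A. \<Sum>x\<in>S. f x y) = (\<Sum>x\<in>S. \<Sum>\<^sub>\<infinity>y\<in>A. f x y)"
    using assms by (induction S) (simp_all add: infsum_add summable_on_add)
  then show "(\<lambda>y. \<Sum>x\<in>S. f x y) summable_on A" "(\<Sum>\<^sub>\<infinity>y\<in>A. \<Sum>x\<in>S. f x y) = (\<Sum>x\<in>S. \<Sum>\<^sub>\<infinity>y\<in>A. f x y)"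
    by auto
qed

text \<open>Schur's test: \<open>2 \<bar>\<psi>(x)\<bar> \<bar>\<psi>(y)\<bar> \<le> \<bar>\<psi>(x)\<bar>\<^sup>2 + \<bar>\<psi>(y)\<bar>\<^sup>2\<close>, and the row and column sums of \<open>\<bar>h(x - y)\<bar>\<close> are equal to \<open>\<parallel>h\<parallel>\<^sub>1\<close>.\<close>

lemma sum_hop_le:
  fixes h :: "int ^ 'd::finite \<Rightarrow> complex"
  assumes h: "(\<lambda>y. cmod (h y)) summable_on UNIV" and \<psi>: "\<psi> \<in> ell2" and S: "finite S"
  shows "(\<Sum>x\<in>S. 2 * cmod (\<psi> x) * cmod (hop h \<psi> x)) \<le> 2 * (\<Sum>\<^sub>\<infinity>y. cmod (h y)) * (\<Sum>\<^sub>\<infinity>x. (cmod (\<psi> x))\<^sup>2)"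
proof -
  define H where "H = (\<Sum>\<^sub>\<infinity>y. cmod (h y))"
  define N where "N = (\<Sum>\<^sub>\<infinity>x. (cmod (\<psi> x))\<^sup>2)"
  have s2: "(\<lambda>x. (cmod (\<psi> x))\<^sup>2) summable_on UNIV" using \<psi> by (simp add: ell2_def)
  have H0: "H \<ge> 0" unfolding H_def by (intro infsum_nonneg) simp
  have bij: "bij (\<lambda>y. x - y)" for x :: "int ^ 'd"
    by (rule bij_betw_byWitness[where f' = "\<lambda>y. x - y"]) auto
  have bij': "bij (\<lambda>x. x - y)" for y :: "int ^ 'd"
    by (rule bij_betw_byWitness[where f' = "\<lambda>x. x + y"]) auto
  have hs: "(\<lambda>y. cmod (h (x - y))) summable_on UNIV" and hsum: "(\<Sum>\<^sub>\<infinity>y. cmod (h (x - y))) = H" for x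
    using summable_on_reindex_bij_betw[OF bij[of x], of "\<lambda>y. cmod (h y)"] infsum_reindex_bij_betw[OF bij[of x], of "\<lambda>y. cmod (h y)"] h
    by (auto simp: H_def)
  have hfin: "(\<Sum>x\<in>S. cmod (h (x - y))) \<le> H" for y
  proof -
    have "(\<lambda>x. cmod (h (x - y))) summable_on UNIV" "(\<Sum>\<^sub>\<infinity>x. cmod (h (x - y))) = H"
      using summable_on_reindex_bij_betw[OF bij'[of y], of "\<lambda>y. cmod (h y)"] infsum_reindex_bij_betw[OF bij'[of y], of "\<lambda>y. cmod (h y)"] h
      by (auto simp: H_def)
    then show ?thesis
      using finite_sum_le_infsum[of "\<lambda>x. cmod (h (x - y))" UNIV S] S by simp
  qed
  have hle: "cmod (h y) \<le> H" for y
    using finite_sum_le_infsum[OF h, of "{y}"] by (simp add: H_def)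
  have s3: "(\<lambda>y. cmod (h (x - y)) * (cmod (\<psi> y))\<^sup>2) summable_on UNIV" for x
    by (rule summable_on_comparison_test[OF summable_on_cmult_right[OF s2, of H]])
      (auto intro: mult_right_mono hle)
  have s4: "(\<lambda>y. cmod (h (x - y)) * ((cmod (\<psi> x))\<^sup>2 + (cmod (\<psi> y))\<^sup>2)) summable_on UNIV" for x
    unfolding distrib_left by (intro summable_on_add s3 summable_on_cmult_left hs)
  have "2 * cmod (\<psi> x) * cmod (hop h \<psi> x) \<le> H * (cmod (\<psi> x))\<^sup>2 + (\<Sum>\<^sub>\<infinity>y. cmod (h (x - y)) * (cmod (\<psi> y))\<^sup>2)" for x
  proof -
    have le: "2 * cmod (\<psi> x) * cmod (h (x - y) * \<psi> y) \<le> cmod (h (x - y)) * ((cmod (\<psi> x))\<^sup>2 + (cmod (\<psi> y))\<^sup>2)" for y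
      using mult_left_mono[OF sum_squares_bound[of "cmod (\<psi> x)" "cmod (\<psi> y)"], of "cmod (h (x - y))"]
      by (simp add: norm_mult mult_ac)
    have s5: "(\<lambda>y. 2 * cmod (\<psi> x) * cmod (h (x - y) * \<psi> y)) summable_on UNIV"
      by (rule summable_on_comparison_test[OF s4[of x]]) (auto intro: le)
    have "2 * cmod (\<psi> x) * cmod (hop h \<psi> x) \<le> 2 * cmod (\<psi> x) * (\<Sum>\<^sub>\<infinity>y. cmod (h (x - y) * \<psi> y))"
    \<comment> \<open>Summability of |h(x - y) \<psi>(y)| over y is read off from \<open>s5\<close>
      by dividing by 2 |\<psi>(x)|, which requires \<psi>(x) to be nonzero.\<close>
    proof (cases "\<psi> x = 0")
      case False
      then have "(\<lambda>y. cmod (h (x - y) * \<psi> y)) summable_on UNIV"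
        using summable_on_cmult_right'[of "2 * cmod (\<psi> x)" "\<lambda>y. cmod (h (x - y) * \<psi> y)" UNIV] s5 by simp
      then show ?thesis unfolding hop_def by (intro mult_left_mono norm_infsum_bound) auto
    qed simp
    also have "\<dots> = (\<Sum>\<^sub>\<infinity>y. 2 * cmod (\<psi> x) * cmod (h (x - y) * \<psi> y))"
      by (rule infsum_cmult_right'[symmetric])
    also have "\<dots> \<le> (\<Sum>\<^sub>\<infinity>y. cmod (h (x - y)) * ((cmod (\<psi> x))\<^sup>2 + (cmod (\<psi> y))\<^sup>2))"
      by (intro infsum_mono s5 s4 le)
    also have "\<dots> = (\<Sum>\<^sub>\<infinity>y. cmod (h (x - y)) * (cmod (\<psi> x))\<^sup>2) + (\<Sum>\<^sub>\<infinity>y. cmod (h (x - y)) * (cmod (\<psi> y))\<^sup>2)"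
      unfolding distrib_left by (intro infsum_add s3 summable_on_cmult_left hs)
    finally show ?thesis by (simp add: infsum_cmult_left' hsum)
  qed
  then have "(\<Sum>x\<in>S. 2 * cmod (\<psi> x) * cmod (hop h \<psi> x)) \<le> (\<Sum>x\<in>S. H * (cmod (\<psi> x))\<^sup>2 + (\<Sum>\<^sub>\<infinity>y. cmod (h (x - y)) * (cmod (\<psi> y))\<^sup>2))"
    by (intro sum_mono)
  also have "\<dots> = H * (\<Sum>x\<in>S. (cmod (\<psi> x))\<^sup>2) + (\<Sum>x\<in>S. \<Sum>\<^sub>\<infinity>y. cmod (h (x - y)) * (cmod (\<psi> y))\<^sup>2)"
    by (simp add: sum.distrib sum_distrib_left)
  also have "(\<Sum>x\<in>S. \<Sum>\<^sub>\<infinity>y. cmod (h (x - y)) * (cmod (\<psi> y))\<^sup>2) = (\<Sum>\<^sub>\<infinity>y. \<Sum>x\<in>S. cmod (h (x - y)) * (cmod (\<psi> y))\<^sup>2)"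
    by (rule infsum_finite_sum(2)[symmetric, OF S s3])
  also have "\<dots> \<le> (\<Sum>\<^sub>\<infinity>y. H * (cmod (\<psi> y))\<^sup>2)"
  proof (rule infsum_mono)
    show "(\<lambda>y. \<Sum>x\<in>S. cmod (h (x - y)) * (cmod (\<psi> y))\<^sup>2) summable_on UNIV"
      by (rule infsum_finite_sum(1)[OF S s3])
    show "(\<Sum>x\<in>S. cmod (h (x - y)) * (cmod (\<psi> y))\<^sup>2) \<le> H * (cmod (\<psi> y))\<^sup>2" for y
      unfolding sum_distrib_right[symmetric] by (intro mult_right_mono hfin) auto
  qed (intro summable_on_cmult_right s2)
  also have "\<dots> = H * N" by (simp add: N_def infsum_cmult_right')
  also have "H * (\<Sum>x\<in>S. (cmod (\<psi> x))\<^sup>2) \<le> H * N"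
    unfolding N_def using finite_sum_le_infsum[OF s2, of S] S H0 by (intro mult_left_mono) auto
  finally show ?thesis by (simp add: H_def N_def)
qed

text \<open>Continuity gives a bound near each time, and bisection joins these local bounds. It
  ensures that the supremum taken in the uniqueness proof is finite.\<close>

lemma ell2_bounded_on_interval:
  fixes \<psi> :: "real \<Rightarrow> 'a \<Rightarrow> complex" and T :: real
  assumes T: "T \<ge> 0" and e: "\<And>t. t \<ge> 0 \<Longrightarrow> \<psi> t \<in> ell2"
    and c: "\<And>t. t \<ge> 0 \<Longrightarrow> ((\<lambda>s. ell2_norm (\<lambda>x. \<psi> s x - \<psi> t x)) \<longlongrightarrow> 0) (at t within {0..})"
  shows "\<exists>M. \<forall>t\<in>{0..T}. (\<Sum>\<^sub>\<infinity>x. (cmod (\<psi> t x))\<^sup>2) \<le> M"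
proof -
  define N where "N t = (\<Sum>\<^sub>\<infinity>x. (cmod (\<psi> t x))\<^sup>2)" for t
  \<comment> \<open>The intersection with \<open>{0..}\<close> is needed because the small intervals
    tested around t = 0 may extend to negative times, where nothing is known about
    \<open>\<psi>\<close>.\<close>
  define Q where "Q a b \<longleftrightarrow> (\<exists>M. \<forall>t\<in>{a..b} \<inter> {0..}. N t \<le> M)" for a b
  have "Q 0 T"
  proof (rule Bolzano[OF T])
    fix a b c assume "Q a b" "Q b c"
    then obtain M1 M2 where "\<forall>t\<in>{a..b} \<inter> {0..}. N t \<le> M1" "\<forall>t\<in>{b..c} \<inter> {0..}. N t \<le> M2"
      unfolding Q_def by blast
    then have "\<forall>t\<in>{a..c} \<inter> {0..}. N t \<le> max M1 M2"
      by (auto simp: le_max_iff_disj)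
    then show "Q a c" unfolding Q_def by blast
  next
    fix t :: real assume t0: "0 \<le> t"
    have "\<forall>\<^sub>F s in at t within {0..}. ell2_norm (\<lambda>x. \<psi> s x - \<psi> t x) < 1"
      using c[OF t0] by (rule order_tendstoD) simp
    then obtain d where d: "d > 0" and dd: "\<And>s. s \<ge> 0 \<Longrightarrow> s \<noteq> t \<Longrightarrow> dist s t < d \<Longrightarrow> ell2_norm (\<lambda>x. \<psi> s x - \<psi> t x) < 1"
      unfolding eventually_at by auto
    \<comment> \<open>From |a + b|^2 \<le> 2 |a|^2 + 2 |b|^2 with a the difference of the two
      states, whose norm is below 1.\<close>
    have bound: "N s \<le> 2 + 2 * N t" if s: "s \<ge> 0" "dist s t < d" for s
    proof -
      have n1: "ell2_norm (\<lambda>x. \<psi> s x - \<psi> t x) < 1"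
        using dd[OF s(1) _ s(2)] by (cases "s = t") (auto simp: ell2_norm_def)
      have ss: "(\<lambda>x. (cmod (\<psi> s x))\<^sup>2) summable_on UNIV" and st: "(\<lambda>x. (cmod (\<psi> t x))\<^sup>2) summable_on UNIV"
        using e[OF s(1)] e[OF t0] by (auto simp: ell2_def)
      have par: "(cmod (a + b))\<^sup>2 \<le> 2 * (cmod a)\<^sup>2 + 2 * (cmod b)\<^sup>2" for a b
      proof -
        have "(cmod (a + b))\<^sup>2 \<le> (cmod a + cmod b)\<^sup>2" by (intro power_mono norm_triangle_ineq) auto
        also have "\<dots> \<le> 2 * (cmod a)\<^sup>2 + 2 * (cmod b)\<^sup>2"
          using sum_squares_bound[of "cmod a" "cmod b"] by (simp add: power2_sum)
        finally show ?thesis .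
      qed
      have sd: "(\<lambda>x. (cmod (\<psi> s x - \<psi> t x))\<^sup>2) summable_on UNIV"
      proof (rule summable_on_comparison_test)
        show "(\<lambda>x. 2 * (cmod (\<psi> s x))\<^sup>2 + 2 * (cmod (\<psi> t x))\<^sup>2) summable_on UNIV"
          by (intro summable_on_add summable_on_cmult_right ss st)
        show "(cmod (\<psi> s x - \<psi> t x))\<^sup>2 \<le> 2 * (cmod (\<psi> s x))\<^sup>2 + 2 * (cmod (\<psi> t x))\<^sup>2" for x
          using par[of "\<psi> s x" "- \<psi> t x"] by simp
      qed simp
      have sq: "(\<Sum>\<^sub>\<infinity>x. (cmod (\<psi> s x - \<psi> t x))\<^sup>2) \<le> 1"
        using n1 unfolding ell2_norm_def by simp
      have "N s \<le> (\<Sum>\<^sub>\<infinity>x. 2 * (cmod (\<psi> s x - \<psi> t x))\<^sup>2 + 2 * (cmod (\<psi> t x))\<^sup>2)"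
        unfolding N_def
      proof (rule infsum_mono[OF ss])
        show "(\<lambda>x. 2 * (cmod (\<psi> s x - \<psi> t x))\<^sup>2 + 2 * (cmod (\<psi> t x))\<^sup>2) summable_on UNIV"
          by (intro summable_on_add summable_on_cmult_right sd st)
        show "(cmod (\<psi> s x))\<^sup>2 \<le> 2 * (cmod (\<psi> s x - \<psi> t x))\<^sup>2 + 2 * (cmod (\<psi> t x))\<^sup>2" for x
          using par[of "\<psi> s x - \<psi> t x" "\<psi> t x"] by simp
      qed
      also have "\<dots> = 2 * (\<Sum>\<^sub>\<infinity>x. (cmod (\<psi> s x - \<psi> t x))\<^sup>2) + 2 * N t"
        unfolding N_def infsum_cmult_right'[symmetric]
        by (intro infsum_add summable_on_cmult_right sd st)
      finally show ?thesis using sq by simp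
    qed
    have "Q a b" if "a \<le> t \<and> t \<le> b \<and> b - a < d" for a b
      unfolding Q_def using that bound by (intro exI[of _ "2 + 2 * N t"]) (auto simp: dist_real_def)
    then show "\<exists>d>0. \<forall>a b. a \<le> t \<and> t \<le> b \<and> b - a < d \<longrightarrow> Q a b" using d by blast
  qed
  then show ?thesis unfolding Q_def N_def by auto
qed

text \<open>Since \<open>V\<close> is real, it drops out of the derivative of \<open>\<bar>\<psi>\<^sub>t(x)\<bar>\<^sup>2\<close>, so no bound on \<open>V\<close> enters. If
  \<open>M\<close> is the supremum of \<open>exp (- 4 H t) \<parallel>\<psi>\<^sub>t\<parallel>\<^sup>2\<close> on \<open>[0, T]\<close>, then integrating the bound \<open>M exp (4 H s)\<close>
  for \<open>\<parallel>\<psi>\<^sub>s\<parallel>\<^sup>2\<close> gives \<open>M \<le> M / 2\<close>.\<close>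

lemma schroedinger_solution_zero:
  fixes h :: "int ^ 'd::finite \<Rightarrow> complex"
  assumes h: "hopping_kernel h" and sol: "schroedinger_solution h V (\<lambda>_. 0) \<psi>" and T: "T \<ge> 0"
  shows "\<psi> T = (\<lambda>_. 0)"
proof -
  note hs = hopping_kernel_summable[OF h]
  define N where "N t = (\<Sum>\<^sub>\<infinity>x. (cmod (\<psi> t x))\<^sup>2)" for t
  \<comment> \<open>The summand 1 makes \<open>H\<close> positive, so 4 H may be divided by in the
    antiderivative. Schur's constant is at most 2 H, half of the rate 4 H, whence the factor
    1/2.\<close>
  define H where "H = 1 + (\<Sum>\<^sub>\<infinity>y. cmod (h y))"
  have H1: "H \<ge> 1" unfolding H_def using infsum_nonneg[of UNIV "\<lambda>y. cmod (h y)"] by simp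
  have e: "\<psi> t \<in> ell2" if "t \<ge> 0" for t using sol that by (simp add: schroedinger_solution_def)
  then have s2: "(\<lambda>x. (cmod (\<psi> t x))\<^sup>2) summable_on UNIV" if "t \<ge> 0" for t using that by (simp add: ell2_def)
  have N0: "N t \<ge> 0" for t unfolding N_def by (intro infsum_nonneg) simp
  have "((\<lambda>s. ell2_norm (\<lambda>x. \<psi> s x - \<psi> t x)) \<longlongrightarrow> 0) (at t within {0..})" if "t \<ge> 0" for t
    using sol that by (simp add: schroedinger_solution_def)
  from ell2_bounded_on_interval[OF T e this] obtain M0 where M0: "\<And>t. t \<in> {0..T} \<Longrightarrow> N t \<le> M0"
    unfolding N_def by blast
  define M where "M = (SUP t\<in>{0..T}. exp (- (4 * H * t)) * N t)"
  have bdd: "bdd_above ((\<lambda>t. exp (- (4 * H * t)) * N t) ` {0..T})"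
  proof (rule bdd_aboveI2)
    fix t assume t: "t \<in> {0..T}"
    then have "exp (- (4 * H * t)) * N t \<le> 1 * N t" using H1 N0 by (intro mult_right_mono) auto
    then show "exp (- (4 * H * t)) * N t \<le> M0" using M0[OF t] by simp
  qed
  have NM: "N t \<le> M * exp (4 * H * t)" if "t \<in> {0..T}" for t
  proof -
    have "exp (- (4 * H * t)) * N t \<le> M" unfolding M_def by (rule cSUP_upper[OF that bdd])
    then have "exp (4 * H * t) * (exp (- (4 * H * t)) * N t) \<le> exp (4 * H * t) * M" by (rule mult_left_mono) simp
    moreover have "exp (4 * H * t) * (exp (- (4 * H * t)) * N t) = N t"
      by (simp only: mult.assoc[symmetric] exp_minus_inverse mult_1_left)
    ultimately show ?thesis by (simp only: mult.commute)
  qed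
  have M00: "M \<ge> 0" using order_trans[OF N0[of 0] NM[of 0]] T by simp
  have half: "N t \<le> M / 2 * exp (4 * H * t)" if t: "t \<in> {0..T}" for t
    unfolding N_def
  \<comment> \<open>For finite \<open>S\<close> the time integral can be taken term by term;
    \<open>N\<close> is bounded pointwise under the integral and never integrated itself.\<close>
  proof (rule infsum_le_finite_sums)
    show "(\<lambda>x. (cmod (\<psi> t x))\<^sup>2) summable_on UNIV" using s2 t by simp
    fix S :: "(int ^ 'd) set" assume S: "finite S"
    define g where "g x s = - \<i> * (hop h (\<psi> s) x + of_real (V x s) * \<psi> s x)" for x s
    have F: "\<psi> r x = (LINT s:{0..r}|lborel. g x s)" if "r \<ge> 0" for r x
    proof -
      have "\<i> * \<psi> r x = (LINT s:{0..r}|lborel. hop h (\<psi> s) x + of_real (V x s) * \<psi> s x)"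
        using sol that by (simp add: schroedinger_solution_def)
      then have "- \<i> * (\<i> * \<psi> r x) = (LINT s:{0..r}|lborel. g x s)"
        unfolding g_def by (simp only: set_integral_mult_right)
      then show ?thesis by (simp add: mult.assoc[symmetric])
    qed
    have gi: "set_integrable lborel {0..t} (g x)" for x
      using sol t unfolding g_def schroedinger_solution_def by (intro set_integrable_mult_right) auto
    have t0: "t \<ge> 0" using t by simp
    let ?k = "\<lambda>x s. 2 * Re (cnj (\<psi> s x) * g x s)"
    \<comment> \<open>Under the integral over \<open>{0..t}\<close> the inner indefinite integral
      may be replaced by \<open>\<psi>\<close> by \<open>F\<close>; outside this interval the
      indicator vanishes.\<close>
    have cong: "(LINT s:{0..t}|lborel. 2 * Re (cnj (LINT r:{0..s}|lborel. g x r) * g x s)) = (LINT s:{0..t}|lborel. ?k x s)"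
      "set_integrable lborel {0..t} (\<lambda>s. cnj (LINT r:{0..s}|lborel. g x r) * g x s) = set_integrable lborel {0..t} (\<lambda>s. cnj (\<psi> s x) * g x s)" for x
      unfolding set_lebesgue_integral_def[where A="{0..t}"] set_integrable_def
      by (intro Bochner_Integration.integral_cong Bochner_Integration.integrable_cong refl; simp add: indicator_def F)+
    have sq: "(cmod (\<psi> t x))\<^sup>2 = (LINT s:{0..t}|lborel. ?k x s)" for x
      using norm_indefinite_integral_squared(2)[OF t0 gi, of x] unfolding F[OF t0, symmetric] cong .
    have ci: "set_integrable lborel {0..t} (\<lambda>s. cnj (\<psi> s x) * g x s)" for x
      using norm_indefinite_integral_squared(1)[OF t0 gi, of x] unfolding cong .
    have ki: "set_integrable lborel {0..t} (?k x)" for x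
      using integrable_mult_right[OF integrable_Re[OF ci[of x, unfolded set_integrable_def]], of 2]
      unfolding set_integrable_def scaleR_complex.simps(1) real_scaleR_def mult.left_commute[of 2] .
    have kle: "?k x s \<le> 2 * cmod (\<psi> s x) * cmod (hop h (\<psi> s) x)" for x s
    proof -
      have "cnj (\<psi> s x) * g x s = - \<i> * (cnj (\<psi> s x) * hop h (\<psi> s) x) - \<i> * of_real (V x s * (cmod (\<psi> s x))\<^sup>2)"
        using complex_norm_square[of "\<psi> s x"] by (simp add: g_def algebra_simps)
      then have "Re (cnj (\<psi> s x) * g x s) = Im (cnj (\<psi> s x) * hop h (\<psi> s) x)" by simp
      also have "\<dots> \<le> cmod (cnj (\<psi> s x) * hop h (\<psi> s) x)"
        by (rule order_trans[OF abs_ge_self abs_Im_le_cmod])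
      finally show ?thesis by (simp add: norm_mult)
    qed
    have ei: "set_integrable lborel {0..t} (\<lambda>s. 2 * H * M * exp (4 * H * s))"
      by (rule borel_integrable_atLeastAtMost') (intro continuous_intros)
    have "(\<Sum>x\<in>S. (cmod (\<psi> t x))\<^sup>2) = (LINT s:{0..t}|lborel. \<Sum>x\<in>S. ?k x s)"
      unfolding sq set_lebesgue_integral_def scaleR_sum_right
      using ki by (intro Bochner_Integration.integral_sum[symmetric]) (auto simp: set_integrable_def)
    also have "\<dots> \<le> (LINT s:{0..t}|lborel. 2 * H * M * exp (4 * H * s))"
    proof (rule set_integral_mono[OF _ ei])
      show "set_integrable lborel {0..t} (\<lambda>s. \<Sum>x\<in>S. ?k x s)"
        using ki unfolding set_integrable_def scaleR_sum_right by (intro Bochner_Integration.integrable_sum) auto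
      fix s assume s: "s \<in> {0..t}"
      have "(\<Sum>x\<in>S. ?k x s) \<le> (\<Sum>x\<in>S. 2 * cmod (\<psi> s x) * cmod (hop h (\<psi> s) x))"
        by (intro sum_mono kle)
      also have "\<dots> \<le> 2 * (\<Sum>\<^sub>\<infinity>y. cmod (h y)) * N s"
        unfolding N_def using s by (intro sum_hop_le[OF hs e S]) auto
      also have "\<dots> \<le> 2 * H * (M * exp (4 * H * s))"
        using s t N0 NM[of s] H1 by (intro mult_mono) (auto simp: H_def)
      finally show "(\<Sum>x\<in>S. ?k x s) \<le> 2 * H * M * exp (4 * H * s)" by (simp add: mult.assoc)
    qed
    also have "\<dots> = (\<integral>s. 2 * H * M * exp (4 * H * s) * indicator {0..t} s \<partial>lborel)"
      unfolding set_lebesgue_integral_def by (simp only: real_scaleR_def mult.commute)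
    also have "\<dots> = M / 2 * exp (4 * H * t) - M / 2 * exp (4 * H * 0)"
      by (rule integral_FTC_Icc_real[OF t0]) (auto intro!: derivative_eq_intros continuous_intros)
    also have "\<dots> \<le> M / 2 * exp (4 * H * t)" using M00 by simp
    finally show "(\<Sum>x\<in>S. (cmod (\<psi> t x))\<^sup>2) \<le> M / 2 * exp (4 * H * t)" .
  qed
  have "M \<le> M / 2"
    unfolding M_def
  proof (rule cSUP_least)
    show "{0..T} \<noteq> {}" using T by simp
    fix t assume "t \<in> {0..T}"
    from mult_left_mono[OF half[OF this], of "exp (- (4 * H * t))"]
    have "exp (- (4 * H * t)) * N t \<le> M / 2"
      by (simp add: exp_minus field_simps)
    then show "exp (- (4 * H * t)) * N t \<le> (SUP t\<in>{0..T}. exp (- (4 * H * t)) * N t) / 2"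
      unfolding M_def .
  qed
  then have "M = 0" using M00 by simp
  then have "N T \<le> 0" using NM[of T] T by simp
  moreover have "(cmod (\<psi> T x))\<^sup>2 \<le> N T" for x
    using finite_sum_le_infsum[OF s2[OF T], of "{x}"] unfolding N_def by simp
  ultimately have "(cmod (\<psi> T x))\<^sup>2 \<le> 0" for x
    by (rule order_trans[rotated])
  then show ?thesis by (auto simp: fun_eq_iff)
qed

text \<open>The zero function shows that the choice in \<open>wave\<close> is made from a nonempty
  set; uniqueness then identifies the chosen solution.\<close>

lemma wave_zero:
  assumes "hopping_kernel h" "t \<ge> 0"
  shows "wave h V (\<lambda>_. 0) t = (\<lambda>_. 0)"
proof -
  have "schroedinger_solution h V (\<lambda>_. 0) (\<lambda>_ _. 0)"
    by (auto simp: schroedinger_solution_def ell2_def ell2_norm_def hop_def set_integrable_def set_lebesgue_integral_def)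
  then have "schroedinger_solution h V (\<lambda>_. 0) (wave h V (\<lambda>_. 0))"
    unfolding wave_def by (rule someI[of "schroedinger_solution h V (\<lambda>_. 0)"])
  then show ?thesis using schroedinger_solution_zero[OF assms(1) _ assms(2)] by blast
qed

section \<open>Diffusive limit of the mean density\<close>

lemma mean_density_nonneg: "mean_density h \<mu> \<sigma> P v0 \<psi>0 t x \<ge> 0"
  by (simp add: mean_density_def)

lemma mean_density_zero:
  assumes "hopping_kernel h" "t \<ge> 0"
  shows "mean_density h \<mu> \<sigma> P v0 (\<lambda>_. 0) t x = 0"
  by (simp add: mean_density_def wave_zero[OF assms])

lemma ell2_norm_pos:
  assumes "\<psi> \<in> ell2" "\<psi> \<noteq> (\<lambda>_. 0)"
  shows "ell2_norm \<psi> > 0"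
proof -
  obtain x where x: "\<psi> x \<noteq> 0" using assms(2) by auto
  have "(cmod (\<psi> x))\<^sup>2 \<le> (\<Sum>\<^sub>\<infinity>x. (cmod (\<psi> x))\<^sup>2)"
    using finite_sum_le_infsum[of "\<lambda>x. (cmod (\<psi> x))\<^sup>2" UNIV "{x}"] assms(1) by (simp add: ell2_def)
  moreover have "(cmod (\<psi> x))\<^sup>2 > 0" using x by simp
  ultimately have "0 < (\<Sum>\<^sub>\<infinity>x. (cmod (\<psi> x))\<^sup>2)" by (rule less_le_trans[rotated])
  then show ?thesis by (simp add: ell2_norm_def)
qed

text \<open>The convergence assumed in \<open>diffusion_matrix\<close> does not mention summability, and \<open>infsum\<close> is \<open>0\<close> for
  families that are not summable. The limit is nonzero unless \<open>\<psi>\<^sub>0 = 0\<close>; in that case the density vanishes.\<close>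

lemma mean_density_exp_converges:
  fixes h :: "int ^ 'd::finite \<Rightarrow> complex"
  assumes h: "hopping_kernel h" and D: "diffusion_matrix h \<mu> \<sigma> P v0 D"
    and \<psi>0: "\<psi>0 \<in> ell2" "exp_localized \<psi>0"
  shows "converges_to_integral ((ell2_norm \<psi>0)\<^sup>2) (mean_density h \<mu> \<sigma> P v0 \<psi>0) (\<lambda>t x. real_pt x /\<^sub>R sqrt t)
     (density lborel (\<lambda>x. ennreal (gaussian_density D x))) (\<lambda>x. exp (\<i> * cdot z (\<chi> j. of_real (x $ j))))"
proof -
  let ?m = "mean_density h \<mu> \<sigma> P v0 \<psi>0" and ?G = "density lborel (\<lambda>x. ennreal (gaussian_density D x))"
  let ?F = "\<lambda>x::real ^ 'd. exp (\<i> * cdot z (\<chi> j. of_real (x $ j)))"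
  let ?S = "\<lambda>t. \<Sum>\<^sub>\<infinity>x. ?F (real_pt x /\<^sub>R sqrt t) * of_real (?m t x)"
  have pd: "positive_definite D" using D by (simp add: diffusion_matrix_def)
  note gp = gaussian_density_pos[OF pd]
  have hb: "has_bochner_integral lborel (\<lambda>x. ?F x * of_real (gaussian_density D x)) (exp (- (1 / 2) * cdot z (complex_mat D *v z)))"
    by (rule has_bochner_integral_exp_gaussian_density[OF pd])
  have Fm: "?F \<in> borel_measurable borel"
    unfolding cdot_def by (intro borel_measurable_continuous_onI continuous_intros)
  have "has_bochner_integral ?G ?F (exp (- (1 / 2) * cdot z (complex_mat D *v z)))"
  proof (rule has_bochner_integral_density)
    show "has_bochner_integral lborel (\<lambda>x. gaussian_density D x *\<^sub>R ?F x) (exp (- (1 / 2) * cdot z (complex_mat D *v z)))"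
      using hb by (simp add: scaleR_conv_of_real mult.commute)
  qed (use Fm gp in \<open>auto intro!: AE_I2 less_imp_le\<close>)
  then have iG: "integrable ?G ?F" and IG: "(\<integral>x. ?F x \<partial>?G) = exp (- (1 / 2) * cdot z (complex_mat D *v z))"
    by (auto simp: has_bochner_integral_iff)
  have scale: "cdot z (\<chi> j. of_real ((real_pt x /\<^sub>R sqrt t) $ j)) = cdot z (complex_pt x) / of_real (sqrt t)" for x t
    by (simp add: cdot_def real_pt_def complex_pt_def sum_distrib_left divide_inverse mult_ac)
  \<comment> \<open>Taken on the compact set \<open>{z}\<close> and with time factor 1, so that
    \<tau> is the physical time t.\<close>
  have "uniform_limit {z} (\<lambda>\<tau> z. \<Sum>\<^sub>\<infinity>x. exp (\<i> * cdot z (complex_pt x) / of_real (sqrt \<tau>)) * of_real (?m (\<tau> * 1) x))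
      (\<lambda>z. of_real ((ell2_norm \<psi>0)\<^sup>2) * exp (- of_real 1 / 2 * cdot z (complex_mat D *v z))) at_top"
    by (rule conjunct2[OF D[unfolded diffusion_matrix_def], rule_format]) (use \<psi>0 in simp)
  from tendsto_uniform_limitI[OF this, of z]
  have lim: "(?S \<longlongrightarrow> of_real ((ell2_norm \<psi>0)\<^sup>2) * (\<integral>x. ?F x \<partial>?G)) at_top"
    unfolding scale IG by simp
  have "\<forall>\<^sub>F t in at_top. (\<lambda>x. ?F (real_pt x /\<^sub>R sqrt t) * of_real (?m t x)) summable_on UNIV"
  proof (cases "\<psi>0 = (\<lambda>_. 0)")
    case True
    show ?thesis
      using eventually_ge_at_top[of 0]
      by eventually_elim (simp add: True mean_density_zero[OF h])
  next
    case False
    have "of_real ((ell2_norm \<psi>0)\<^sup>2) * (\<integral>x. ?F x \<partial>?G) \<noteq> 0"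
      unfolding IG using ell2_norm_pos[OF \<psi>0(1) False] by simp
    then have "\<forall>\<^sub>F t in at_top. ?S t \<noteq> 0"
      using lim by (rule tendsto_imp_eventually_ne[rotated])
    then show ?thesis by eventually_elim (meson infsum_not_exists)
  qed
  then show ?thesis unfolding converges_to_integral_def using iG lim by (intro conjI)
qed

section \<open>Powers of the norm and the limit for real observables\<close>

lemma polynomially_bounded_norm_powr:
  assumes "p > 0"
  shows "polynomially_bounded (\<lambda>x::'a::real_normed_vector. norm x powr p)"
  unfolding polynomially_bounded_def
proof (intro exI allI)
  fix x :: 'a
  have "norm x powr p \<le> (1 + norm x) powr p" using assms by (intro powr_mono2) auto
  also have "\<dots> \<le> (1 + norm x) powr real (nat \<lceil>p\<rceil>)" by (intro powr_mono) (auto simp: real_nat_ceiling_ge)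
  also have "\<dots> = 1 * (1 + norm x) ^ nat \<lceil>p\<rceil>"
    using add_pos_nonneg[OF zero_less_one norm_ge_zero[of x]] by (simp add: powr_realpow)
  finally show "\<bar>norm x powr p\<bar> \<le> 1 * (1 + norm x) ^ nat \<lceil>p\<rceil>" by simp
qed

text \<open>The integrand is positive away from the origin, which is a null set. This makes the
  limit of the rescaled moments positive.\<close>

lemma integral_norm_powr_gaussian_pos:
  fixes D :: "real ^ 'd ^ 'd::finite"
  assumes "positive_definite D" and i: "integrable lborel (\<lambda>x. norm x powr p * gaussian_density D x)"
  shows "(\<integral>x. norm x powr p * gaussian_density D x \<partial>lborel) > 0"
proof -
  note gp = gaussian_density_pos[OF assms(1)]
  have nn: "norm x powr p * gaussian_density D x \<ge> 0" for x using gp[of x] by simp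
  have "(\<integral>x. norm x powr p * gaussian_density D x \<partial>lborel) \<noteq> 0"
  proof
    assume "(\<integral>x. norm x powr p * gaussian_density D x \<partial>lborel) = 0"
    then have "AE x in lborel. norm x powr p * gaussian_density D x = 0"
      using integral_nonneg_eq_0_iff_AE[OF i] nn by simp
    moreover have "AE x in lborel. x \<noteq> (0 :: real ^ 'd)" by (rule AE_lborel_singleton)
    ultimately have "AE x in (lborel :: (real ^ 'd) measure). False"
    proof eventually_elim
      case (elim x)
      then show ?case using gp[of x] by simp
    qed
    then have "emeasure (lborel :: (real ^ 'd) measure) (space lborel) = 0"
      by (simp add: eventually_False ae_filter_eq_bot_iff)
    then show False by simp
  qed
  moreover have "(\<integral>x. norm x powr p * gaussian_density D x \<partial>lborel) \<ge> 0"
    using nn by (intro Bochner_Integration.integral_nonneg)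
  ultimately show ?thesis by simp
qed

text \<open>Stated for arbitrary \<open>f\<close> because it is applied twice, to the given function
  and to the powers of the norm. Taking real parts returns from complex to real sums.\<close>

lemma mean_density_limit:
  fixes h :: "int ^ 'd::finite \<Rightarrow> complex"
  assumes h: "hopping_kernel h" and D: "diffusion_matrix h \<mu> \<sigma> P v0 D"
    and f: "continuous_on UNIV f" "polynomially_bounded f"
    and \<psi>0: "\<psi>0 \<in> ell2" "exp_localized \<psi>0"
  shows "\<forall>\<^sub>F t in at_top. (\<lambda>x. f (real_pt x /\<^sub>R sqrt t) * mean_density h \<mu> \<sigma> P v0 \<psi>0 t x) summable_on UNIV"
    and "integrable lborel (\<lambda>x. f x * gaussian_density D x)"
    and "((\<lambda>t. \<Sum>\<^sub>\<infinity>x. f (real_pt x /\<^sub>R sqrt t) * mean_density h \<mu> \<sigma> P v0 \<psi>0 t x) \<longlongrightarrow>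
        (ell2_norm \<psi>0)\<^sup>2 * (\<integral>x. f x * gaussian_density D x \<partial>lborel)) at_top"
proof -
  let ?m = "mean_density h \<mu> \<sigma> P v0 \<psi>0" and ?G = "density lborel (\<lambda>x. ennreal (gaussian_density D x))"
  have pd: "positive_definite D" using D by (simp add: diffusion_matrix_def)
  note gp = gaussian_density_pos[OF pd]
  have fm: "f \<in> borel_measurable borel" using f(1) by (rule borel_measurable_continuous_onI)
  have "converges_to_integral ((ell2_norm \<psi>0)\<^sup>2) ?m (\<lambda>t x. real_pt x /\<^sub>R sqrt t) ?G (\<lambda>x. of_real (f x))"
    by (rule converges_to_integral_polynomially_bounded[OF _ mean_density_nonneg _ mean_density_exp_converges[OF h D \<psi>0] f])
      simp_all
  then have ev: "\<forall>\<^sub>F t in at_top. (\<lambda>x. complex_of_real (f (real_pt x /\<^sub>R sqrt t)) * of_real (?m t x)) summable_on UNIV"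
    and iG: "integrable ?G f"
    and lim: "((\<lambda>t. \<Sum>\<^sub>\<infinity>x. complex_of_real (f (real_pt x /\<^sub>R sqrt t)) * of_real (?m t x)) \<longlongrightarrow>
      of_real ((ell2_norm \<psi>0)\<^sup>2) * (\<integral>x. of_real (f x) \<partial>?G)) at_top"
    by (auto simp: converges_to_integral_def complex_of_real_integrable_eq)
  show ev': "\<forall>\<^sub>F t in at_top. (\<lambda>x. f (real_pt x /\<^sub>R sqrt t) * ?m t x) summable_on UNIV"
    using ev by eventually_elim (auto dest: summable_on_Re)
  show "integrable lborel (\<lambda>x. f x * gaussian_density D x)"
    using iG gp fm by (subst (asm) integrable_density) (auto intro!: AE_I2 less_imp_le simp: mult.commute)
  have int: "(\<integral>x. f x \<partial>?G) = (\<integral>x. f x * gaussian_density D x \<partial>lborel)"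
    using gp fm by (subst integral_density) (auto intro!: AE_I2 less_imp_le simp: mult.commute)
  show "((\<lambda>t. \<Sum>\<^sub>\<infinity>x. f (real_pt x /\<^sub>R sqrt t) * ?m t x) \<longlongrightarrow>
        (ell2_norm \<psi>0)\<^sup>2 * (\<integral>x. f x * gaussian_density D x \<partial>lborel)) at_top"
  proof (rule Lim_transform_eventually)
    show "((\<lambda>t. Re (\<Sum>\<^sub>\<infinity>x. complex_of_real (f (real_pt x /\<^sub>R sqrt t)) * of_real (?m t x))) \<longlongrightarrow>
        (ell2_norm \<psi>0)\<^sup>2 * (\<integral>x. f x * gaussian_density D x \<partial>lborel)) at_top"
      using tendsto_Re[OF lim] by (simp add: int)
    show "\<forall>\<^sub>F t in at_top. Re (\<Sum>\<^sub>\<infinity>x. complex_of_real (f (real_pt x /\<^sub>R sqrt t)) * of_real (?m t x)) =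
        (\<Sum>\<^sub>\<infinity>x. f (real_pt x /\<^sub>R sqrt t) * ?m t x)"
      using ev by eventually_elim (simp add: infsum_Re[symmetric])
  qed
qed

theorem corollary1:
  fixes h :: "int ^ 'd::finite \<Rightarrow> complex"
    and \<mu> :: "'w::topological_space measure"
    and \<sigma> :: "int ^ 'd \<Rightarrow> 'w \<Rightarrow> 'w"
    and P :: "'w \<Rightarrow> (real \<Rightarrow> 'w) measure"
    and v0 :: "'w \<Rightarrow> real"
    and D :: "real ^ 'd ^ 'd"
    and f :: "real ^ 'd \<Rightarrow> real"
    and \<psi>0 :: "int ^ 'd \<Rightarrow> complex"
  assumes "hopping_kernel h"
    and "measure_preserving_shifts \<mu> \<sigma>"
    and "markov_process \<mu> \<sigma> P"
    and "gap_sectorial \<mu> P"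
    and "nondegenerate_potential \<mu> \<sigma> P v0"
    and "diffusion_matrix h \<mu> \<sigma> P v0 D"
    and "continuous_on UNIV f" and "polynomially_bounded f"
    and "\<psi>0 \<in> ell2" and "exp_localized \<psi>0"
  shows
    "(\<forall>\<^sub>F t in at_top.
        (\<lambda>x. f (real_pt x /\<^sub>R sqrt t) * mean_density h \<mu> \<sigma> P v0 \<psi>0 t x) summable_on UNIV) \<and>
     integrable lborel (\<lambda>x. f x * gaussian_density D x) \<and>
     ((\<lambda>t. \<Sum>\<^sub>\<infinity>x. f (real_pt x /\<^sub>R sqrt t) * mean_density h \<mu> \<sigma> P v0 \<psi>0 t x) \<longlongrightarrow>
        (ell2_norm \<psi>0)\<^sup>2 * (\<integral>x. f x * gaussian_density D x \<partial>lborel)) at_top \<and>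
     (\<psi>0 \<noteq> (\<lambda>_. 0) \<longrightarrow>
        (\<forall>p>0.
          (\<forall>\<^sub>F t in at_top.
             (\<lambda>x. norm (real_pt x) powr p * mean_density h \<mu> \<sigma> P v0 \<psi>0 t x) summable_on UNIV) \<and>
          (\<exists>L>0. ((\<lambda>t. t powr (- p / 2) *
              (\<Sum>\<^sub>\<infinity>x. norm (real_pt x) powr p * mean_density h \<mu> \<sigma> P v0 \<psi>0 t x)) \<longlongrightarrow> L) at_top)))"
proof (intro conjI impI allI)
  note limit = mean_density_limit[OF assms(1,6) _ _ assms(9,10)]
  show "\<forall>\<^sub>F t in at_top. (\<lambda>x. f (real_pt x /\<^sub>R sqrt t) * mean_density h \<mu> \<sigma> P v0 \<psi>0 t x) summable_on UNIV"
    and "integrable lborel (\<lambda>x. f x * gaussian_density D x)"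
    and "((\<lambda>t. \<Sum>\<^sub>\<infinity>x. f (real_pt x /\<^sub>R sqrt t) * mean_density h \<mu> \<sigma> P v0 \<psi>0 t x) \<longlongrightarrow>
        (ell2_norm \<psi>0)\<^sup>2 * (\<integral>x. f x * gaussian_density D x \<partial>lborel)) at_top"
    by (rule limit[OF assms(7,8)])+
  fix p :: real
  assume nz: "\<psi>0 \<noteq> (\<lambda>_. 0)" and p: "p > 0"
  let ?m = "mean_density h \<mu> \<sigma> P v0 \<psi>0"
  let ?f = "\<lambda>x::real ^ 'd. norm x powr p"
  have "continuous_on UNIV ?f"
    using p by (intro continuous_on_powr' continuous_intros) auto
  note lf = limit[OF this polynomially_bounded_norm_powr[OF p]]
  \<comment> \<open>Homogeneity of the norm moves the spatial scaling into the prefactor t^(-p/2); t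
    > 0 holds eventually.\<close>
  have scale: "?f (real_pt x /\<^sub>R sqrt t) * ?m t x = t powr (- p / 2) * (norm (real_pt x) powr p * ?m t x)"
    if "t > 0" for x t
  proof -
    have "?f (real_pt x /\<^sub>R sqrt t) = inverse (sqrt t) powr p * norm (real_pt x) powr p"
      using that by (simp add: powr_mult)
    also have "inverse (sqrt t) powr p = t powr (- p / 2)"
      using that by (simp add: powr_half_sqrt[symmetric] powr_powr powr_minus[symmetric])
    finally show ?thesis by (simp add: mult.assoc)
  qed
  show "\<forall>\<^sub>F t in at_top. (\<lambda>x. norm (real_pt x) powr p * ?m t x) summable_on UNIV"
    using lf(1) eventually_gt_at_top[of 0]
  proof eventually_elim
    case (elim t)
    from elim(1) have "(\<lambda>x. t powr (- p / 2) * (norm (real_pt x) powr p * ?m t x)) summable_on UNIV"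
      by (simp only: scale[OF elim(2)])
    then show ?case using elim(2) by (subst (asm) summable_on_cmult_right') auto
  qed
  have "((\<lambda>t. t powr (- p / 2) * (\<Sum>\<^sub>\<infinity>x. norm (real_pt x) powr p * ?m t x)) \<longlongrightarrow>
      (ell2_norm \<psi>0)\<^sup>2 * (\<integral>x. ?f x * gaussian_density D x \<partial>lborel)) at_top"
  proof (rule Lim_transform_eventually[OF lf(3)])
    show "\<forall>\<^sub>F t in at_top. (\<Sum>\<^sub>\<infinity>x. ?f (real_pt x /\<^sub>R sqrt t) * ?m t x) =
        t powr (- p / 2) * (\<Sum>\<^sub>\<infinity>x. norm (real_pt x) powr p * ?m t x)"
      using eventually_gt_at_top[of 0]
    proof eventually_elim
      case (elim t)
      then show ?case by (simp only: scale infsum_cmult_right')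
    qed
  qed
  moreover have "(ell2_norm \<psi>0)\<^sup>2 * (\<integral>x. ?f x * gaussian_density D x \<partial>lborel) > 0"
    using ell2_norm_pos[OF assms(9) nz] integral_norm_powr_gaussian_pos[OF _ lf(2)] assms(6)
    by (simp add: diffusion_matrix_def)
  ultimately show "\<exists>L>0. ((\<lambda>t. t powr (- p / 2) * (\<Sum>\<^sub>\<infinity>x. norm (real_pt x) powr p * ?m t x)) \<longlongrightarrow> L) at_top"
    by blast
qed

end
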